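(* Let $q$ be a complex number with $0<|q|<1$, fix a choice of $q^{1/8}$, and interpret every power $q^{k/8}$ ($k\in\mathbb{Z}$) as $(q^{1/8})^k$. Put $$P=\frac{f(-q)f(-q^{9})}{q^{5/4}f(-q^{4})f(-q^{36})},\qquad Q=\frac{f(-q^{3})^2}{q^{3/4}f(-q^{12})^2}.$$ Then $$\left(\frac{P}{Q}+\frac{Q}{P}\right)^3=Q^2+\frac{16}{Q^2}.$$
   Context: For $|x|<1$, $f(-x):=(x;x)_\infty=\prod_{n=1}^{\infty}(1-x^n)$, where $(a;x)_\infty=\prod_{n\ge 0}(1-ax^n)$. *)

theory Defs
  imports "HOL-Analysis.Analysis"
begin

definition qpoch_inf :: "complex \<Rightarrow> complex \<Rightarrow> complex" where
  "qpoch_inf a x = (\<Prod>n. 1 - a * x ^ n)"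

text \<open>
  Ramanujan's one-variable theta function, in the convention \<open>f(-x) = (x; x)\<^sub>\<infinity>\<close>;
  the argument carries the minus sign. It is meant for arguments of modulus less than 1.
\<close>

definition ramanujan_f :: "complex \<Rightarrow> complex" where
  "ramanujan_f y = qpoch_inf (- y) (- y)"

lemma ramanujan_f_minus: "ramanujan_f (- x) = (\<Prod>n. 1 - x ^ Suc n)"
  by (simp add: ramanujan_f_def qpoch_inf_def)

lemma convergent_prod_ramanujan_f:
  fixes x :: complex
  assumes "norm x < 1"
  shows "convergent_prod (\<lambda>n. 1 - x ^ Suc n)"
proof -
  have "summable (\<lambda>n. norm x ^ Suc n)"
    using assms by (subst summable_Suc_iff) (simp add: summable_geometric)
  then have "summable (\<lambda>n. norm ((1 - x ^ Suc n) - 1))"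
    by (simp add: norm_mult norm_power del: summable_Suc_iff)
  then show ?thesis
    by (intro abs_convergent_prod_imp_convergent_prod summable_imp_abs_convergent_prod)
qed

end

theory Submission
  imports Defs
begin

text \<open>
  Write \<open>E\<^sub>n = f(-q\<^sup>n)\<close>. Jacobi's quartic identity \<open>\<phi>(q)\<^sup>4 - \<phi>(-q)\<^sup>4 = 16 q \<psi>(q\<^sup>2)\<^sup>4\<close> at \<open>q\<^sup>3\<close>
  makes \<open>Q\<^sup>2 + 16 / Q\<^sup>2\<close> the cube of the eta quotient \<open>Z = E\<^sub>6\<^sup>8 / (q\<^sup>1\<^sup>/\<^sup>2 E\<^sub>3\<^sup>4 E\<^sub>1\<^sub>2\<^sup>4)\<close>,
  so it suffices that \<open>P / Q + Q / P = Z\<close>.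

  Splitting the theta series modulo 3 gives \<open>\<phi>(-q) = \<phi>(-q\<^sup>9) (1 - 2w)\<close> and
  \<open>\<psi>(q) = q \<psi>(q\<^sup>9) (1 + 1/w)\<close> with the same eta quotient \<open>w\<close>; multiplying over
  \<open>q, \<omega>q, \<omega>\<^sup>2q\<close> for a primitive cube root of unity \<open>\<omega>\<close> gives the analogous statements for
  \<open>1 - 8w\<^sup>3\<close> and \<open>1 + 1/w\<^sup>3\<close>. Let \<open>a = w(q)\<close>, \<open>b = w(-q)\<close>, \<open>c = w(q\<^sup>2)\<close>. Then \<open>ab = -c\<close>, and
  \<open>\<phi>(q) \<phi>(-q) = \<phi>(-q\<^sup>2)\<^sup>2\<close> yields \<open>a + b = -2c\<^sup>2\<close>. With \<open>t = a/c = -1/b\<close> this is the curve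
  \<open>at\<^sup>2 - t + 2a\<^sup>2 = 0\<close>, on which
  \<open>P\<^sup>2/Q\<^sup>2 = (1 - 2a)(t\<^sup>2 + t + 1) / ((t - 1)(1 + 2a + 4a\<^sup>2))\<close> and
  \<open>P\<^sup>2/Q\<^sup>2 + 1 = t\<^sup>2 (1 - 8c\<^sup>3) / ((t - 1)(1 + 2a + 4a\<^sup>2))\<close>. Every factor is an eta quotient.
\<close>

section \<open>The Jacobi triple product\<close>

text \<open>The Gaussian binomial coefficient, encoded by its q-Pascal rule instead of a quotient:
  it makes sense for every \<open>q\<close>, roots of unity included.\<close>

fun qbinom :: "complex \<Rightarrow> nat \<Rightarrow> nat \<Rightarrow> complex" where
  "qbinom q 0 0 = 1"
| "qbinom q 0 (Suc j) = 0"
| "qbinom q (Suc N) 0 = 1"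
| "qbinom q (Suc N) (Suc j) = q ^ Suc j * qbinom q N (Suc j) + qbinom q N j"

lemma qbinom_0_right [simp]: "qbinom q N 0 = 1"
  by (cases N) auto

lemma qbinom_eq_0: "N < j \<Longrightarrow> qbinom q N j = 0"
  by (induction q N j rule: qbinom.induct) auto

lemma qbinom_diag [simp]: "qbinom q N N = 1"
  by (induction N) (simp_all add: qbinom_eq_0)

text \<open>The q-analogue of the factorial formula, with denominators cleared. The q-Pascal rule
  reduces it to \<open>q^(j+1) (1 - q^(m+1)) + (1 - q^(j+1)) = 1 - q^(j+m+2)\<close>.\<close>

lemma qbinom_factorial:
  assumes "j \<le> N"
  shows "qbinom q N j * ((\<Prod>i<j. 1 - q ^ Suc i) * (\<Prod>i<N - j. 1 - q ^ Suc i)) = (\<Prod>i<N. 1 - q ^ Suc i)"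
  using assms
proof (induction q N j rule: qbinom.induct)
  case (4 q N j)
  define D where "D = (\<lambda>n. \<Prod>i<n. 1 - q ^ Suc i)"
  have D_Suc: "D (Suc n) = D n * (1 - q ^ Suc n)" for n by (simp add: D_def)
  have j: "j \<le> N" using 4 by simp
  have IH2: "qbinom q N j * (D j * D (N - j)) = D N"
    using 4(2) j by (simp add: D_def)
  show ?case
  proof (cases "j = N")
    case True
    then show ?thesis by (simp add: qbinom_eq_0)
  next
    case False
    then obtain m where m: "N = Suc (j + m)" using j less_imp_Suc_add[of j N] by auto
    have IH1: "qbinom q N (Suc j) * (D (Suc j) * D m) = D N"
      using 4(1) by (simp add: D_def m)
    have "qbinom q (Suc N) (Suc j) * (D (Suc j) * D (Suc N - Suc j)) =
          q ^ Suc j * (1 - q ^ Suc m) * (qbinom q N (Suc j) * (D (Suc j) * D m))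
          + (1 - q ^ Suc j) * (qbinom q N j * (D j * D (N - j)))"
      by (simp add: m D_Suc algebra_simps)
    also have "\<dots> = D N * (1 - q ^ Suc N)"
      unfolding IH1 IH2 by (simp add: m algebra_simps power_add)
    also have "\<dots> = D (Suc N)" by (simp add: D_Suc)
    finally show ?thesis by (simp only: D_def)
  qed
qed auto

text \<open>Removing the factor \<open>i = 0\<close> leaves a shorter product of the same shape at
  \<open>x * q\<close>; the coefficients of \<open>x ^ Suc j\<close> then combine by the q-Pascal
  rule.\<close>

lemma qbinomial_theorem:
  "(\<Prod>i<N. 1 + x * q ^ i) = (\<Sum>j\<le>N. q ^ (j * (j - 1) div 2) * qbinom q N j * x ^ j)"
proof (induction N arbitrary: x)
  case (Suc N)
  have tri: "Suc j * (Suc j - 1) div 2 = j * (j - 1) div 2 + j" for j :: nat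
    by (cases j) (simp_all add: algebra_simps)
  let ?g = "\<lambda>j. q ^ (j * (j - 1) div 2) * q ^ j * qbinom q N j * x ^ j"
  have "(\<Prod>i<Suc N. 1 + x * q ^ i) = (1 + x) * (\<Prod>i<N. 1 + (x * q) * q ^ i)"
    by (subst prod.lessThan_Suc_shift) (simp add: algebra_simps)
  also have "\<dots> = (1 + x) * (\<Sum>j\<le>N. ?g j)"
    by (subst Suc.IH) (simp add: power_mult_distrib algebra_simps)
  also have "\<dots> = (\<Sum>j\<le>Suc N. ?g j) + (\<Sum>j\<le>N. x * ?g j)"
    by (simp add: distrib_right sum.distrib sum_distrib_left qbinom_eq_0)
  also have "(\<Sum>j\<le>Suc N. ?g j) = 1 + (\<Sum>j\<le>N. ?g (Suc j))"
    by (subst sum.atMost_Suc_shift) simp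
  also have "1 + (\<Sum>j\<le>N. ?g (Suc j)) + (\<Sum>j\<le>N. x * ?g j) = 1 + (\<Sum>j\<le>N. ?g (Suc j) + x * ?g j)"
    by (simp add: sum.distrib)
  also have "(\<Sum>j\<le>N. ?g (Suc j) + x * ?g j) =
     (\<Sum>j\<le>N. q ^ (Suc j * (Suc j - 1) div 2) * qbinom q (Suc N) (Suc j) * x ^ Suc j)"
    by (intro sum.cong refl, subst (1 2) tri) (simp add: power_add algebra_simps)
  also have "1 + \<dots> = (\<Sum>j\<le>Suc N. q ^ (j * (j - 1) div 2) * qbinom q (Suc N) j * x ^ j)"
    by (subst sum.atMost_Suc_shift) simp
  finally show ?case .
qed auto

lemma prod_lessThan_add:
  "(\<Prod>i<m + n. f i) = (\<Prod>i<m. f i) * (\<Prod>i<n. f (m + i :: nat) :: 'a :: comm_monoid_mult)"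
  by (induction n) (simp_all add: mult_ac)

section \<open>The bilateral theta series and a finite triple product\<close>

definition theta_term :: "complex \<Rightarrow> complex \<Rightarrow> int \<Rightarrow> complex" where
  "theta_term a q k = (- a) powi k * q powi (k * (k - 1) div 2)"

text \<open>This is the q-binomial theorem with \<open>2 * n\<close> factors at
  \<open>x = - a q^(-n)\<close>. The upper half of the factors is the first product; the lower half
  is the second one times the monomial \<open>K\<close>, which cancels once the summation index is
  centred at \<open>n\<close>.\<close>

lemma finite_triple_product:
  assumes "q \<noteq> 0" "a \<noteq> 0"
  shows "(\<Prod>i<n. 1 - a * q ^ i) * (\<Prod>i<n. 1 - q / a * q ^ i) =
         (\<Sum>k\<in>{- int n..int n}. theta_term a q k * qbinom q (2 * n) (nat (int n + k)))"
proof -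
  define x where "x = - a * q powi (- int n)"
  define K where "K = (- a) ^ n * q powi (- (int n * (int n + 1) div 2))"
  have nz: "K \<noteq> 0" using assms by (simp add: K_def)
  \<comment> \<open>Each factor is turned around by
    \<open>1 - a q^(-s) = - a q^(-s) (1 - (q/a) q^(s-1))\<close>; the prefactors for
    \<open>s = 1, ..., m\<close> multiply to the monomial in front.\<close>
  have shift: "(\<Prod>i<m. 1 - a * q powi (int i - int m)) =
      (- a) ^ m * q powi (- (int m * (int m + 1) div 2)) * (\<Prod>i<m. 1 - q / a * q ^ i)" for m
  proof (induction m)
    case (Suc m)
    have e: "(int (Suc m)) * (int (Suc m) + 1) div 2 = int m * (int m + 1) div 2 + int (Suc m)"
    proof -
      have "(int (Suc m)) * (int (Suc m) + 1) = int m * (int m + 1) + int (Suc m) * 2"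
        by (simp add: algebra_simps)
      then show ?thesis by simp
    qed
    define R where "R = (\<Prod>i<m. 1 - q / a * q ^ i)"
    have IH: "(\<Prod>i<m. 1 - a * q powi (int i - int m)) =
        (- a) ^ m * q powi (- (int m * (int m + 1) div 2)) * R"
      using Suc.IH by (simp add: R_def)
    have "(\<Prod>i<Suc m. 1 - a * q powi (int i - int (Suc m))) =
        (1 - a * q powi (- int (Suc m))) * (\<Prod>i<m. 1 - a * q powi (int i - int m))"
      by (subst prod.lessThan_Suc_shift) simp
    also have "1 - a * q powi (- int (Suc m)) = - a * q powi (- int (Suc m)) * (1 - q / a * q ^ m)"
    proof -
      have "q powi (- int (Suc m)) * (q * q ^ m) = 1"
        unfolding power_int_minus power_int_of_nat using assms by (simp add: field_simps)
      then show ?thesis using assms by (simp add: algebra_simps del: of_nat_Suc)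
    qed
    also have "\<dots> * (\<Prod>i<m. 1 - a * q powi (int i - int m)) =
      (- a) ^ Suc m * (q powi (- int (Suc m)) * q powi (- (int m * (int m + 1) div 2))) * (R * (1 - q / a * q ^ m))"
      unfolding IH by (simp add: mult_ac del: of_nat_Suc)
    also have "q powi (- int (Suc m)) * q powi (- (int m * (int m + 1) div 2))
        = q powi (- (int (Suc m) * (int (Suc m) + 1) div 2))"
      unfolding e using assms by (subst power_int_add [symmetric]) simp_all
    finally show ?case by (simp add: R_def del: of_nat_Suc)
  qed auto
  have "(\<Prod>i<2 * n. 1 + x * q ^ i) = (\<Prod>i<n. 1 + x * q ^ i) * (\<Prod>i<n. 1 + x * q ^ (n + i))"
    by (simp add: mult_2 prod_lessThan_add)
  also have "(\<Prod>i<n. 1 + x * q ^ i) = (\<Prod>i<n. 1 - a * q powi (int i - int n))"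
    using assms by (intro prod.cong refl) (simp add: x_def power_int_diff power_int_minus field_simps)
  also have "\<dots> = K * (\<Prod>i<n. 1 - q / a * q ^ i)"
    by (simp add: shift K_def)
  also have "(\<Prod>i<n. 1 + x * q ^ (n + i)) = (\<Prod>i<n. 1 - a * q ^ i)"
    using assms by (intro prod.cong refl) (simp add: x_def power_add power_int_minus)
  finally have prod_eq: "(\<Prod>i<2 * n. 1 + x * q ^ i) =
    K * ((\<Prod>i<n. 1 - a * q ^ i) * (\<Prod>i<n. 1 - q / a * q ^ i))" by (simp add: mult_ac)
  \<comment> \<open>Completing the square:
    \<open>j(j-1)/2 - n j = (j-n)(j-n-1)/2 - n(n+1)/2\<close>. It is checked after doubling, where
    the integer divisions disappear.\<close>
  have term_eq: "q ^ (j * (j - 1) div 2) * x ^ j = K * theta_term a q (int j - int n)" for j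
  proof -
    have "2 * (int j * (int j - 1) div 2) = int j * (int j - 1)" by simp
    moreover have "2 * ((int j - int n) * (int j - int n - 1) div 2) = (int j - int n) * (int j - int n - 1)"
      by (rule dvd_mult_div_cancel) auto
    moreover have "2 * (int n * (int n + 1) div 2) = int n * (int n + 1)" by simp
    ultimately have "2 * (int j * (int j - 1) div 2 + (- int n) * int j) =
       2 * (- (int n * (int n + 1) div 2) + (int j - int n) * (int j - int n - 1) div 2)"
      by (simp only: distrib_left mult_minus_right) (simp add: algebra_simps)
    then have e: "int j * (int j - 1) div 2 + (- int n) * int j =
       - (int n * (int n + 1) div 2) + (int j - int n) * (int j - int n - 1) div 2"
      by (simp only: mult_cancel_left) simp
    have "int (j * (j - 1) div 2) = int j * (int j - 1) div 2"
    proof -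
      have "int (j * (j - 1)) = int j * (int j - 1)" by (cases j) (simp_all add: algebra_simps)
      then show ?thesis by (metis zdiv_int of_nat_numeral)
    qed
    then have "q ^ (j * (j - 1) div 2) = q powi (int j * (int j - 1) div 2)"
      by (metis power_int_of_nat)
    moreover have "x ^ j = (- a) ^ j * q powi ((- int n) * int j)"
      unfolding x_def power_mult_distrib by (simp only: power_int_mult power_int_of_nat)
    ultimately have "q ^ (j * (j - 1) div 2) * x ^ j =
       (- a) ^ j * q powi (int j * (int j - 1) div 2 + (- int n) * int j)"
      using assms by (subst power_int_add) simp_all
    also have "(- a) ^ j = (- a) ^ n * (- a) powi (int j - int n)"
      using assms by (subst power_int_diff) simp_all
    also have "q powi (int j * (int j - 1) div 2 + (- int n) * int j) =
        q powi (- (int n * (int n + 1) div 2)) * q powi ((int j - int n) * (int j - int n - 1) div 2)"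
      unfolding e using assms by (subst power_int_add) simp_all
    also have "(- a) ^ n * (- a) powi (int j - int n) *
        (q powi (- (int n * (int n + 1) div 2)) * q powi ((int j - int n) * (int j - int n - 1) div 2)) =
        K * theta_term a q (int j - int n)"
      by (simp only: K_def theta_term_def mult_ac)
    finally show ?thesis .
  qed
  have "(\<Prod>i<2 * n. 1 + x * q ^ i) = K * (\<Sum>j\<le>2 * n. theta_term a q (int j - int n) * qbinom q (2 * n) j)"
    unfolding qbinomial_theorem sum_distrib_left
  proof (intro sum.cong refl)
    fix j
    have "q ^ (j * (j - 1) div 2) * qbinom q (2 * n) j * x ^ j =
        q ^ (j * (j - 1) div 2) * x ^ j * qbinom q (2 * n) j" by (simp only: mult_ac)
    then show "q ^ (j * (j - 1) div 2) * qbinom q (2 * n) j * x ^ j =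
        K * (theta_term a q (int j - int n) * qbinom q (2 * n) j)"
      by (simp only: term_eq mult.assoc)
  qed
  also have "(\<Sum>j\<le>2 * n. theta_term a q (int j - int n) * qbinom q (2 * n) j) =
    (\<Sum>k\<in>{- int n..int n}. theta_term a q k * qbinom q (2 * n) (nat (int n + k)))"
    by (rule sum.reindex_bij_witness[of _ "\<lambda>k. nat (int n + k)" "\<lambda>j. int j - int n"]) auto
  finally show ?thesis using prod_eq nz by simp
qed

section \<open>Convergence of the infinite products and of the bilateral series\<close>

lemma convergent_prod_qpoch:
  fixes a x :: complex
  assumes "norm x < 1"
  shows "convergent_prod (\<lambda>n. 1 - a * x ^ n)"
proof -
  have "summable (\<lambda>n. norm a * norm x ^ n)"
    using assms by (intro summable_mult) simp
  then have "summable (\<lambda>n. norm ((1 - a * x ^ n) - 1))"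
    by (simp add: norm_mult norm_power)
  then show ?thesis
    by (intro abs_convergent_prod_imp_convergent_prod summable_imp_abs_convergent_prod)
qed

lemma qpoch_inf_has_prod:
  "norm x < 1 \<Longrightarrow> (\<lambda>n. 1 - a * x ^ n) has_prod qpoch_inf a x"
  unfolding qpoch_inf_def by (intro convergent_prod_has_prod convergent_prod_qpoch)

lemma qpoch_inf_LIMSEQ:
  "norm x < 1 \<Longrightarrow> (\<lambda>n. \<Prod>i<n. 1 - a * x ^ i) \<longlonglongrightarrow> qpoch_inf a x"
  by (intro has_prod_imp_tendsto' qpoch_inf_has_prod)

lemma qpoch_inf_self_nonzero:
  assumes "norm x < 1"
  shows "qpoch_inf x x \<noteq> 0"
proof -
  have "x * x ^ n \<noteq> 1" for n
  proof
    assume "x * x ^ n = 1"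
    then have "norm x ^ Suc n = 1" by (metis norm_one norm_power power_Suc)
    then show False using power_Suc_less_one[of "norm x" n] assms
      by (metis norm_ge_zero order_less_irrefl power_eq_0_iff power_strict_decreasing
          zero_less_Suc zero_neq_one less_eq_real_def power_0)
  qed
  then show ?thesis unfolding qpoch_inf_def
    by (intro prodinf_nonzero convergent_prod_qpoch assms) auto
qed

lemma theta_term_plus_1:
  assumes "q \<noteq> 0" "a \<noteq> 0"
  shows "theta_term a q (k + 1) = - a * q powi k * theta_term a q k"
proof -
  have "(k + 1) * (k + 1 - 1) = k * (k - 1) + k * 2" by (simp add: algebra_simps)
  then have "(k + 1) * (k + 1 - 1) div 2 = k * (k - 1) div 2 + k" by simp
  then show ?thesis using assms by (simp add: theta_term_def power_int_add)
qed

text \<open>The symmetry that exchanges the two factors \<open>qpoch_inf a q\<close> and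
  \<open>qpoch_inf (q / a) q\<close> of the triple product; it reduces negative indices to
  nonnegative ones.\<close>

lemma theta_term_uminus:
  assumes "q \<noteq> 0" "a \<noteq> 0"
  shows "theta_term a q (- k) = theta_term (q / a) q k"
proof -
  have "- k * (- k - 1) = k * (k - 1) + k * 2" by (simp add: algebra_simps)
  then have "- k * (- k - 1) div 2 = k * (k - 1) div 2 + k" by simp
  moreover have "(- (q / a)) powi k = (- a) powi (- k) * q powi k"
    using assms by (simp add: power_int_divide_distrib power_int_minus field_simps
      flip: power_int_mult_distrib)
  ultimately show ?thesis using assms by (simp add: theta_term_def power_int_add)
qed

lemma theta_term_summable_nat:
  assumes "q \<noteq> 0" "norm q < 1" "a \<noteq> 0"
  shows "summable (\<lambda>n. norm (theta_term a q (int n)))"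
proof -
  \<comment> \<open>This is the modulus of the ratio of consecutive terms. It tends to 0 for every
    \<open>a\<close>, so any bound below 1 would serve in the ratio test.\<close>
  have "(\<lambda>n. norm a * norm q ^ n) \<longlonglongrightarrow> norm a * 0"
    using assms by (intro tendsto_intros) (simp add: LIMSEQ_power_zero)
  then have "eventually (\<lambda>n. norm a * norm q ^ n < 1 / 2) sequentially"
    by (rule order_tendstoD) simp
  then obtain N where N: "\<And>n. n \<ge> N \<Longrightarrow> norm a * norm q ^ n < 1 / 2"
    by (auto simp: eventually_at_top_linorder)
  show ?thesis
  proof (rule summable_ratio_test)
    fix n assume "N \<le> n"
    have "norm (theta_term a q (int (Suc n))) = norm a * norm q ^ n * norm (theta_term a q (int n))"
      using theta_term_plus_1[of q a "int n"] assms
      by (simp add: add.commute norm_mult norm_power)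
    also have "\<dots> \<le> 1 / 2 * norm (theta_term a q (int n))"
      using N[OF \<open>N \<le> n\<close>] by (intro mult_right_mono) auto
    finally show "norm (norm (theta_term a q (int (Suc n)))) \<le> 1 / 2 * norm (norm (theta_term a q (int n)))"
      by simp
  qed simp
qed

lemma theta_term_abs_summable:
  assumes "q \<noteq> 0" "norm q < 1" "a \<noteq> 0"
  shows "(\<lambda>k. norm (theta_term a q k)) summable_on UNIV"
proof -
  have nonneg: "(\<lambda>k. norm (theta_term b q k)) summable_on range int" if "b \<noteq> 0" for b
    using theta_term_summable_nat[OF assms(1,2) that]
    by (subst summable_on_reindex) (auto simp: o_def intro!: summable_nonneg_imp_summable_on)
  have "(\<lambda>k. norm (theta_term a q k)) summable_on uminus ` range int"
    using nonneg[of "q / a"] assms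
    by (subst summable_on_reindex) (auto simp: o_def theta_term_uminus)
  then have "(\<lambda>k. norm (theta_term a q k)) summable_on (range int \<union> uminus ` range int)"
    by (intro summable_on_union nonneg assms)
  moreover have "range int \<union> uminus ` range int = UNIV"
    by (auto simp: image_image) (metis int_cases2 rangeI)
  ultimately show ?thesis by simp
qed

text \<open>Limit of the finite version. For fixed \<open>k\<close> the Gaussian binomial tends to
  \<open>1 / qpoch_inf q q\<close>, and a bound uniform in \<open>n\<close> and \<open>k\<close>
  allows the limit to be taken termwise by dominated convergence.\<close>

theorem jacobi_triple_product:
  assumes "q \<noteq> 0" "norm q < 1" "a \<noteq> 0"
  shows "(theta_term a q has_sum (qpoch_inf q q * qpoch_inf a q * qpoch_inf (q / a) q)) UNIV"
proof -
  define D where "D = (\<lambda>n. \<Prod>i<n. 1 - q ^ Suc i)"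
  define S where "S = (\<Sum>\<^sub>\<infinity>k. theta_term a q k)"
  have Dlim: "D \<longlonglongrightarrow> qpoch_inf q q"
    using qpoch_inf_LIMSEQ[of q q] assms by (simp add: D_def)
  note D_inf_nz = qpoch_inf_self_nonzero[OF assms(2)]
  \<comment> \<open>A vanishing partial product would make all later ones vanish, and with them the
    nonzero limit.\<close>
  have D_nz: "D n \<noteq> 0" for n
  proof -
    have "D n dvd D (n + m)" for m by (induction m) (auto simp: D_def intro: dvd_mult2)
    then have "D n = 0 \<Longrightarrow> D (n + m) = 0" for m by (metis dvd_0_left_iff)
    then have "D n = 0 \<Longrightarrow> (\<lambda>m. D (m + n)) \<longlonglongrightarrow> 0" by (simp add: add.commute)
    then show ?thesis using LIMSEQ_ignore_initial_segment[OF Dlim, of n] D_inf_nz LIMSEQ_unique by blast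
  qed
  have inv_lim: "(\<lambda>n. inverse (D n)) \<longlonglongrightarrow> inverse (qpoch_inf q q)"
    by (intro tendsto_inverse Dlim D_inf_nz)
  obtain M1 where M1: "\<And>n. norm (D n) \<le> M1" "M1 > 0"
    using convergent_imp_Bseq[OF convergentI[OF Dlim]] by (elim BseqE) blast
  obtain M2 where M2: "\<And>n. norm (inverse (D n)) \<le> M2" "M2 > 0"
    using convergent_imp_Bseq[OF convergentI[OF inv_lim]] by (elim BseqE) blast
  \<comment> \<open>The coefficients are extended by 0 to all integers, so that every finite sum
    runs over the same index set as the limit series.\<close>
  define B where "B = (\<lambda>n k. if k \<in> {- int n..int n} then qbinom q (2 * n) (nat (int n + k)) else 0)"
  have B_eq: "B n k = D (2 * n) * (inverse (D (nat (int n + k))) * inverse (D (nat (int n - k))))"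
    if "k \<in> {- int n..int n}" for n k
  proof -
    have "2 * n - nat (int n + k) = nat (int n - k)" "nat (int n + k) \<le> 2 * n"
      using that by auto
    then have "qbinom q (2 * n) (nat (int n + k)) * (D (nat (int n + k)) * D (nat (int n - k))) = D (2 * n)"
      using qbinom_factorial[of "nat (int n + k)" "2 * n" q] that by (simp add: D_def)
    then show ?thesis using that D_nz by (simp add: B_def field_simps)
  qed
  have B_bound: "norm (B n k) \<le> M1 * (M2 * M2)" for n k
  proof (cases "k \<in> {- int n..int n}")
    case True
    show ?thesis unfolding B_eq[OF True] norm_mult
      by (intro mult_mono M1 M2 mult_nonneg_nonneg norm_ge_zero less_imp_le[OF M1(2)] less_imp_le[OF M2(2)])
  next
    case False
    then have "B n k = 0" unfolding B_def by (rule if_not_P)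
    then show ?thesis using M1 M2 by simp
  qed
  have B_lim: "(\<lambda>n. B n k) \<longlonglongrightarrow> inverse (qpoch_inf q q)" for k
  proof -
    have l1: "filterlim (\<lambda>n. nat (int n + k)) at_top sequentially"
    proof (unfold filterlim_at_top eventually_at_top_linorder, intro allI exI impI)
      fix Z n assume "n \<ge> nat (int Z - k)"
      then show "Z \<le> nat (int n + k)" by auto
    qed
    have l2: "filterlim (\<lambda>n. nat (int n - k)) at_top sequentially"
    proof (unfold filterlim_at_top eventually_at_top_linorder, intro allI exI impI)
      fix Z n assume "n \<ge> nat (int Z + k)"
      then show "Z \<le> nat (int n - k)" by auto
    qed
    have l3: "filterlim (\<lambda>n::nat. 2 * n) at_top sequentially"
      by (rule filterlim_subseq) (simp add: strict_mono_def)
    have "(\<lambda>n. D (2 * n) * (inverse (D (nat (int n + k))) * inverse (D (nat (int n - k)))))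
       \<longlonglongrightarrow> qpoch_inf q q * (inverse (qpoch_inf q q) * inverse (qpoch_inf q q))"
      by (intro tendsto_mult filterlim_compose[OF Dlim l3] filterlim_compose[OF inv_lim l1]
          filterlim_compose[OF inv_lim l2])
    moreover have "eventually (\<lambda>n. D (2 * n) * (inverse (D (nat (int n + k))) * inverse (D (nat (int n - k)))) = B n k) sequentially"
      using eventually_ge_at_top[of "nat \<bar>k\<bar>"] by eventually_elim (rule B_eq [symmetric], auto)
    ultimately have "(\<lambda>n. B n k) \<longlonglongrightarrow> qpoch_inf q q * (inverse (qpoch_inf q q) * inverse (qpoch_inf q q))"
      by (rule Lim_transform_eventually)
    moreover have "qpoch_inf q q * (inverse (qpoch_inf q q) * inverse (qpoch_inf q q)) = inverse (qpoch_inf q q)"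
      using D_inf_nz by (simp add: field_simps)
    ultimately show ?thesis by (simp only:)
  qed
  have abs_summable: "Infinite_Set_Sum.abs_summable_on (theta_term a q) UNIV"
    using theta_term_abs_summable[OF assms] by (simp flip: abs_summable_equivalent)
  \<comment> \<open>Sums over the integers are read as integrals for counting measure; this is the
    dominating function.\<close>
  have int_bound: "integrable (count_space UNIV) (\<lambda>k. norm (theta_term a q k) * (M1 * (M2 * M2)))"
    using abs_summable unfolding Infinite_Set_Sum.abs_summable_on_def
    by (intro integrable_mult_left integrable_norm)
  have lim1: "(\<lambda>n. integral\<^sup>L (count_space UNIV) (\<lambda>k. theta_term a q k * B n k))
      \<longlonglongrightarrow> integral\<^sup>L (count_space UNIV) (\<lambda>k. theta_term a q k * inverse (qpoch_inf q q))"
    by (rule integral_dominated_convergence[OF _ _ int_bound])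
       (auto simp: norm_mult intro!: tendsto_intros mult_left_mono B_bound B_lim)
  have "integral\<^sup>L (count_space UNIV) (theta_term a q) = S"
    using infsetsum_infsum[OF abs_summable] by (simp add: S_def infsetsum_def)
  then have int_theta: "integral\<^sup>L (count_space UNIV) (\<lambda>k. theta_term a q k * inverse (qpoch_inf q q)) =
      S * inverse (qpoch_inf q q)"
    by simp
  have int_partial: "integral\<^sup>L (count_space UNIV) (\<lambda>k. theta_term a q k * B n k) =
     (\<Prod>i<n. 1 - a * q ^ i) * (\<Prod>i<n. 1 - q / a * q ^ i)" for n
  proof -
    have sub: "{k \<in> UNIV. theta_term a q k * B n k \<noteq> 0} \<subseteq> {- int n..int n}"
      by (auto simp: B_def)
    have "integral\<^sup>L (count_space UNIV) (\<lambda>k. theta_term a q k * B n k) =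
        (\<Sum>k | k \<in> UNIV \<and> theta_term a q k * B n k \<noteq> 0. theta_term a q k * B n k)"
      using finite_subset[OF sub] by (intro lebesgue_integral_count_space_finite_support) simp
    also have "\<dots> = (\<Sum>k\<in>{- int n..int n}. theta_term a q k * B n k)"
      using sub by (intro sum.mono_neutral_left) auto
    also have "\<dots> = (\<Sum>k\<in>{- int n..int n}. theta_term a q k * qbinom q (2 * n) (nat (int n + k)))"
      by (intro sum.cong) (auto simp: B_def)
    finally show ?thesis using finite_triple_product[OF assms(1,3)] by simp
  qed
  have "(\<lambda>n. (\<Prod>i<n. 1 - a * q ^ i) * (\<Prod>i<n. 1 - q / a * q ^ i)) \<longlonglongrightarrow> S * inverse (qpoch_inf q q)"
    using lim1 by (simp only: int_theta int_partial)
  moreover have "(\<lambda>n. (\<Prod>i<n. 1 - a * q ^ i) * (\<Prod>i<n. 1 - q / a * q ^ i)) \<longlonglongrightarrow> qpoch_inf a q * qpoch_inf (q / a) q"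
    using assms by (intro tendsto_mult qpoch_inf_LIMSEQ)
  ultimately have "S * inverse (qpoch_inf q q) = qpoch_inf a q * qpoch_inf (q / a) q"
    by (rule LIMSEQ_unique)
  then have "S = qpoch_inf q q * qpoch_inf a q * qpoch_inf (q / a) q"
    using D_inf_nz by (simp add: field_simps)
  moreover have "theta_term a q summable_on UNIV"
    using theta_term_abs_summable[OF assms] by (rule abs_summable_summable)
  ultimately show ?thesis unfolding S_def by (auto simp: has_sum_iff)
qed

section \<open>Infinite products and roots of unity\<close>

lemma qpoch_inf_first_factor:
  assumes "norm x < 1"
  shows "qpoch_inf a x = (1 - a) * qpoch_inf (a * x) x"
proof (rule LIMSEQ_unique)
  show "(\<lambda>n. \<Prod>i<Suc n. 1 - a * x ^ i) \<longlonglongrightarrow> qpoch_inf a x"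
    using qpoch_inf_LIMSEQ[OF assms] by (rule LIMSEQ_Suc)
  have "(\<Prod>i<Suc n. 1 - a * x ^ i) = (1 - a) * (\<Prod>i<n. 1 - (a * x) * x ^ i)" for n
    by (subst prod.lessThan_Suc_shift) (simp add: mult_ac)
  moreover have "(\<lambda>n. (1 - a) * (\<Prod>i<n. 1 - (a * x) * x ^ i)) \<longlonglongrightarrow> (1 - a) * qpoch_inf (a * x) x"
    by (intro tendsto_mult tendsto_const qpoch_inf_LIMSEQ assms)
  ultimately show "(\<lambda>n. \<Prod>i<Suc n. 1 - a * x ^ i) \<longlonglongrightarrow> (1 - a) * qpoch_inf (a * x) x"
    by simp
qed

text \<open>Partial products of length \<open>n * m\<close> form a subsequence with the same limit,
  and in them the exponents can be sorted by residue modulo \<open>m\<close>.\<close>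

lemma qpoch_inf_split:
  assumes "norm x < 1" "m > 0"
  shows "qpoch_inf a x = (\<Prod>j<m. qpoch_inf (a * x ^ j) (x ^ m))"
proof (rule LIMSEQ_unique)
  show "(\<lambda>n. \<Prod>i<n * m. 1 - a * x ^ i) \<longlonglongrightarrow> qpoch_inf a x"
    using assms by (intro filterlim_compose[OF qpoch_inf_LIMSEQ] filterlim_subseq) (auto simp: strict_mono_def)
  have "(\<Prod>i<n * m. 1 - a * x ^ i) = (\<Prod>j<m. \<Prod>i<n. 1 - (a * x ^ j) * (x ^ m) ^ i)" for n
  proof -
    have "(\<Prod>i<n * m. 1 - a * x ^ i) = (\<Prod>i<n. \<Prod>j<m. 1 - a * x ^ (i * m + j))"
      unfolding prod.nat_group[symmetric]
    proof (rule prod.cong[OF refl])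
      fix i
      show "(\<Prod>k = i * m..<i * m + m. 1 - a * x ^ k) = (\<Prod>j<m. 1 - a * x ^ (i * m + j))"
        using prod.shift_bounds_nat_ivl[of "\<lambda>k. 1 - a * x ^ k" 0 "i * m" m]
        by (simp add: lessThan_atLeast0 add.commute)
    qed
    also have "\<dots> = (\<Prod>j<m. \<Prod>i<n. 1 - (a * x ^ j) * (x ^ m) ^ i)"
      by (subst prod.swap) (simp add: power_add power_mult[symmetric] mult_ac)
    finally show ?thesis .
  qed
  moreover have "norm (x ^ m) < 1"
    using assms by (simp add: norm_power power_less_one_iff)
  then have "(\<lambda>n. \<Prod>j<m. \<Prod>i<n. 1 - (a * x ^ j) * (x ^ m) ^ i) \<longlonglongrightarrow> (\<Prod>j<m. qpoch_inf (a * x ^ j) (x ^ m))"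
    by (intro tendsto_prod qpoch_inf_LIMSEQ)
  ultimately show "(\<lambda>n. \<Prod>i<n * m. 1 - a * x ^ i) \<longlonglongrightarrow> (\<Prod>j<m. qpoch_inf (a * x ^ j) (x ^ m))"
    by simp
qed

lemma norm_power_less_1: "norm (x :: complex) < 1 \<Longrightarrow> n > 0 \<Longrightarrow> norm (x ^ n) < 1"
  by (simp add: norm_power power_less_one_iff)

lemma qpoch_inf_mult_uminus:
  assumes "norm x < 1"
  shows "qpoch_inf a x * qpoch_inf (- a) x = qpoch_inf (a\<^sup>2) (x\<^sup>2)"
proof -
  have "(\<lambda>n. (1 - a * x ^ n) * (1 - (- a) * x ^ n)) has_prod (qpoch_inf a x * qpoch_inf (- a) x)"
    by (intro has_prod_mult qpoch_inf_has_prod assms)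
  also have "(\<lambda>n. (1 - a * x ^ n) * (1 - (- a) * x ^ n)) = (\<lambda>n. 1 - a\<^sup>2 * (x\<^sup>2) ^ n)"
    by (simp add: fun_eq_iff algebra_simps power2_eq_square power_mult_distrib)
  finally show ?thesis
    using qpoch_inf_has_prod[of "x\<^sup>2" "a\<^sup>2"] norm_power_less_1[OF assms] has_prod_unique2 by simp
qed

text \<open>Factor by factor, \<open>(1 - y)(1 - w y)(1 - w^2 y) = 1 - y^3\<close>; the hypothesis
  on \<open>w\<close> makes it a primitive cube root of unity.\<close>

lemma qpoch_inf_mult_cube_root:
  assumes "norm x < 1" "w\<^sup>2 + w + 1 = 0"
  shows "qpoch_inf a x * qpoch_inf (w * a) x * qpoch_inf (w\<^sup>2 * a) x = qpoch_inf (a ^ 3) (x ^ 3)"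
proof -
  have "(\<lambda>n. (1 - a * x ^ n) * (1 - (w * a) * x ^ n) * (1 - (w\<^sup>2 * a) * x ^ n)) has_prod
      (qpoch_inf a x * qpoch_inf (w * a) x * qpoch_inf (w\<^sup>2 * a) x)"
    by (intro has_prod_mult qpoch_inf_has_prod assms)
  moreover have "(1 - y) * (1 - w * y) * (1 - w\<^sup>2 * y) = 1 - y ^ 3" for y
    using assms(2) by algebra
  from this[of "a * x ^ n" for n]
  have "(\<lambda>n. (1 - a * x ^ n) * (1 - (w * a) * x ^ n) * (1 - (w\<^sup>2 * a) * x ^ n)) = (\<lambda>n. 1 - a ^ 3 * (x ^ 3) ^ n)"
    by (simp add: fun_eq_iff mult.assoc power_mult_distrib flip: power_mult) (simp add: mult.commute)
  ultimately show ?thesis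
    using qpoch_inf_has_prod[of "x ^ 3" "a ^ 3"] norm_power_less_1[OF assms(1)] has_prod_unique2 by simp
qed

section \<open>Euler's product under a sign change and under rotation by a cube root of
  unity\<close>

definition euler_prod :: "complex \<Rightarrow> complex" where
  "euler_prod x = qpoch_inf x x"

lemma ramanujan_f_uminus: "ramanujan_f (- x) = euler_prod x"
  by (simp add: ramanujan_f_def euler_prod_def)

lemma euler_prod_nonzero: "norm x < 1 \<Longrightarrow> euler_prod x \<noteq> 0"
  by (simp add: euler_prod_def qpoch_inf_self_nonzero)

lemma euler_prod_split2:
  assumes "norm x < 1"
  shows "euler_prod x = qpoch_inf x (x\<^sup>2) * euler_prod (x\<^sup>2)"
  using qpoch_inf_split[OF assms, of 2 x] by (simp add: euler_prod_def eval_nat_numeral)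

lemma qpoch_inf_split3:
  assumes "norm x < 1"
  shows "qpoch_inf a x = qpoch_inf a (x ^ 3) * qpoch_inf (a * x) (x ^ 3) * qpoch_inf (a * x\<^sup>2) (x ^ 3)"
  using qpoch_inf_split[OF assms, of 3 a] by (simp add: eval_nat_numeral)

lemma qpoch_inf_uminus_self:
  assumes "norm x < 1"
  shows "qpoch_inf (- x) x * euler_prod x = euler_prod (x\<^sup>2)"
  using qpoch_inf_mult_uminus[OF assms, of x] by (simp add: euler_prod_def mult.commute)

text \<open>Splitting by parity, the even exponents do not see the sign, and the odd parts multiply
  to \<open>(x^2; x^4)\<close>, which \<open>euler_prod (x ^ 4)\<close> completes to
  \<open>euler_prod (x\<^sup>2)\<close>.\<close>

lemma euler_prod_uminus:
  assumes "norm x < 1"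
  shows "euler_prod (- x) * euler_prod x * euler_prod (x ^ 4) = euler_prod (x\<^sup>2) ^ 3"
proof -
  have x2: "norm (x\<^sup>2) < 1" by (intro norm_power_less_1 assms) simp
  have "euler_prod (- x) * euler_prod x * euler_prod (x ^ 4) =
     (qpoch_inf x (x\<^sup>2) * qpoch_inf (- x) (x\<^sup>2)) * euler_prod (x ^ 4) * euler_prod (x\<^sup>2) ^ 2"
    using euler_prod_split2[OF assms] euler_prod_split2[of "- x"] assms
    by (simp add: power2_eq_square)
  also have "\<dots> = qpoch_inf (x\<^sup>2) ((x\<^sup>2)\<^sup>2) * euler_prod ((x\<^sup>2)\<^sup>2) * euler_prod (x\<^sup>2) ^ 2"
    by (subst qpoch_inf_mult_uminus[OF x2]) simp
  also have "\<dots> = euler_prod (x\<^sup>2) ^ 3"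
    by (subst euler_prod_split2[OF x2, symmetric]) (simp add: eval_nat_numeral)
  finally show ?thesis .
qed

text \<open>Splitting modulo 3, the exponents divisible by 3 do not see \<open>w\<close>. The other
  two classes multiply to \<open>(x^3; x^9)\<close> and \<open>(x^6; x^9)\<close>, which
  \<open>euler_prod (x ^ 9)\<close> completes to a fourth copy of
  \<open>euler_prod (x ^ 3)\<close>.\<close>

lemma euler_prod_cube_root:
  assumes "norm x < 1" "w\<^sup>2 + w + 1 = 0"
  shows "euler_prod x * euler_prod (w * x) * euler_prod (w\<^sup>2 * x) * euler_prod (x ^ 9) = euler_prod (x ^ 3) ^ 4"
proof -
  have x3: "norm (x ^ 3) < 1" by (intro norm_power_less_1 assms) simp
  have w3: "w ^ 3 = 1" using assms(2) by algebra
  then have nw: "norm w = 1" by (metis norm_one norm_power power_eq_1_iff zero_neq_numeral norm_ge_zero abs_of_nonneg)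
  have split: "euler_prod y = qpoch_inf y (x ^ 3) * qpoch_inf (y\<^sup>2) (x ^ 3) * euler_prod (x ^ 3)"
    if "norm y < 1" "y ^ 3 = x ^ 3" for y
    using qpoch_inf_split3[OF that(1), of y] that(2)
    by (simp add: euler_prod_def power2_eq_square power3_eq_cube mult.assoc)
  have 1: "euler_prod (w * x) = qpoch_inf (w * x) (x ^ 3) * qpoch_inf (w\<^sup>2 * x\<^sup>2) (x ^ 3) * euler_prod (x ^ 3)"
    using split[of "w * x"] assms nw w3 by (simp add: norm_mult power_mult_distrib)
  have "(w\<^sup>2 * x)\<^sup>2 = w * x\<^sup>2" "(w\<^sup>2 * x) ^ 3 = x ^ 3" using w3 by algebra+
  then have 2: "euler_prod (w\<^sup>2 * x) = qpoch_inf (w\<^sup>2 * x) (x ^ 3) * qpoch_inf (w * x\<^sup>2) (x ^ 3) * euler_prod (x ^ 3)"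
    using split[of "w\<^sup>2 * x"] assms nw by (simp add: norm_mult norm_power)
  have "euler_prod x * euler_prod (w * x) * euler_prod (w\<^sup>2 * x) * euler_prod (x ^ 9) =
    (qpoch_inf x (x ^ 3) * qpoch_inf (w * x) (x ^ 3) * qpoch_inf (w\<^sup>2 * x) (x ^ 3)) *
    (qpoch_inf (x\<^sup>2) (x ^ 3) * qpoch_inf (w * x\<^sup>2) (x ^ 3) * qpoch_inf (w\<^sup>2 * x\<^sup>2) (x ^ 3)) *
    euler_prod (x ^ 3) ^ 3 * euler_prod (x ^ 9)"
    unfolding 1 2 split[OF assms(1) refl] by (simp add: power3_eq_cube mult_ac)
  also have "\<dots> = (qpoch_inf (x ^ 3) ((x ^ 3) ^ 3) * qpoch_inf (x ^ 3 * x ^ 3) ((x ^ 3) ^ 3) *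
       qpoch_inf (x ^ 3 * (x ^ 3)\<^sup>2) ((x ^ 3) ^ 3)) * euler_prod (x ^ 3) ^ 3"
    unfolding qpoch_inf_mult_cube_root[OF x3 assms(2)]
    by (simp add: euler_prod_def mult_ac flip: power_mult power_add)
  also have "\<dots> = euler_prod (x ^ 3) ^ 4"
    unfolding qpoch_inf_split3[OF x3, symmetric] by (simp add: euler_prod_def eval_nat_numeral)
  finally show ?thesis .
qed

section \<open>Dissections of theta series\<close>

text \<open>In the classical notation, \<open>theta_phi x\<close> is \<open>\<phi>(-x)\<close> and \<open>theta_psi x\<close> is \<open>\<psi>(x)\<close>.\<close>

definition theta_phi :: "complex \<Rightarrow> complex" where
  "theta_phi x = (euler_prod x)\<^sup>2 / euler_prod (x\<^sup>2)"

definition theta_psi :: "complex \<Rightarrow> complex" where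
  "theta_psi x = (euler_prod (x\<^sup>2))\<^sup>2 / euler_prod x"

lemma two_mult_div_2: "even n \<Longrightarrow> 2 * (n div 2) = (n :: int)"
  by simp

lemma half_eqI: "n = m + 2 * k \<Longrightarrow> n div 2 = m div 2 + (k :: int)"
  by simp

lemma minus_1_powi_square: "(- 1) powi (k * k) = (- 1 :: complex) powi k"
  by (simp add: power_int_minus_left)

section \<open>Product forms of four theta series\<close>

text \<open>The triple product with base \<open>x^2\<close> at \<open>a = x\<close>: both remaining
  factors are \<open>(x; x^2)\<close>, the quotient of \<open>euler_prod x\<close> by
  \<open>euler_prod (x\<^sup>2)\<close>.\<close>

lemma theta_phi_has_sum:
  assumes "x \<noteq> 0" "norm x < 1"
  shows "((\<lambda>k. (- 1) powi k * x powi (k * k)) has_sum theta_phi x) UNIV"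
proof -
  have x2: "norm (x\<^sup>2) < 1" by (intro norm_power_less_1 assms) simp
  have "theta_term x (x\<^sup>2) k = (- 1) powi k * x powi (k * k)" for k
  proof -
    have "(x\<^sup>2) powi (k * (k - 1) div 2) = x powi (2 * (k * (k - 1) div 2))"
      by (simp only: power_int_mult power_int_numeral)
    also have "2 * (k * (k - 1) div 2) = k * k - k"
      by (subst two_mult_div_2) (auto simp: algebra_simps)
    finally show ?thesis
      using assms by (simp add: theta_term_def power_int_diff power_int_minus_left)
  qed
  then have "theta_term x (x\<^sup>2) = (\<lambda>k. (- 1) powi k * x powi (k * k))" by auto
  moreover have "qpoch_inf (x\<^sup>2) (x\<^sup>2) * qpoch_inf x (x\<^sup>2) * qpoch_inf (x\<^sup>2 / x) (x\<^sup>2) = theta_phi x"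
    using euler_prod_split2[OF assms(2)] euler_prod_nonzero[OF x2] assms
    by (simp add: theta_phi_def euler_prod_def power2_eq_square)
  ultimately show ?thesis
    using jacobi_triple_product[OF _ x2 assms(1)] assms by simp
qed

text \<open>The triple product at \<open>a = - x\<close>. The 2 is the first factor of
  \<open>(-1; x)\<close>; on the series side, \<open>k\<close> and \<open>- 1 - k\<close> give the
  same triangular number.\<close>

lemma theta_psi_has_sum:
  assumes "x \<noteq> 0" "norm x < 1"
  shows "((\<lambda>k. x powi (k * (k + 1) div 2)) has_sum (2 * theta_psi x)) UNIV"
proof -
  have "theta_term (- x) x k = x powi (k * (k + 1) div 2)" for k
  proof -
    have "k * (k + 1) div 2 = k * (k - 1) div 2 + k"
      by (rule half_eqI) (simp add: algebra_simps)
    then show ?thesis using assms by (simp add: theta_term_def power_int_add)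
  qed
  then have "theta_term (- x) x = (\<lambda>k. x powi (k * (k + 1) div 2))" by auto
  moreover have "qpoch_inf x x * qpoch_inf (- x) x * qpoch_inf (x / - x) x = 2 * theta_psi x"
    using qpoch_inf_uminus_self[OF assms(2)] qpoch_inf_first_factor[OF assms(2), of "- 1"]
      euler_prod_nonzero[OF assms(2)] assms
    by (simp add: theta_psi_def euler_prod_def power2_eq_square field_simps)
  ultimately show ?thesis
    using jacobi_triple_product[OF assms, of "- x"] assms by simp
qed

text \<open>In Ramanujan's two-variable notation this is \<open>f(x, x^2)\<close>. Its product is
  \<open>(-x; x)\<close>, a quotient of Euler products, with the exponents divisible by 3
  removed.\<close>

lemma pentagonal_has_sum:
  assumes "x \<noteq> 0" "norm x < 1"
  shows "((\<lambda>k. x powi ((3 * k * k + k) div 2)) has_sum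
    (euler_prod (x\<^sup>2) * (euler_prod (x ^ 3))\<^sup>2 / (euler_prod x * euler_prod (x ^ 6)))) UNIV"
proof -
  have x3: "norm (x ^ 3) < 1" by (intro norm_power_less_1 assms) simp
  have x6: "norm (x ^ 6) < 1" by (intro norm_power_less_1 assms) simp
  have "theta_term (- x\<^sup>2) (x ^ 3) k = x powi ((3 * k * k + k) div 2)" for k
  proof -
    have "(x ^ 3) powi (k * (k - 1) div 2) = x powi (3 * (k * (k - 1) div 2))"
      by (simp only: power_int_mult power_int_numeral)
    moreover have "(x\<^sup>2) powi k = x powi (2 * k)"
      by (simp add: power_int_mult)
    moreover have "(3 * k * k + k) div 2 = 3 * (k * (k - 1) div 2) + 2 * k"
    proof -
      define t where "t = k * (k - 1) div 2"
      have "2 * t = k * (k - 1)" unfolding t_def by (rule two_mult_div_2) simp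
      then have "3 * k * k + k = (3 * (k * (k - 1) div 2) + 2 * k) * 2" unfolding t_def [symmetric] by (simp add: algebra_simps)
      then show ?thesis by simp
    qed
    ultimately show ?thesis using assms by (simp add: theta_term_def power_int_add)
  qed
  then have "theta_term (- x\<^sup>2) (x ^ 3) = (\<lambda>k. x powi ((3 * k * k + k) div 2))" by auto
  moreover have "x ^ 3 / - x\<^sup>2 = - x" using assms by (simp add: power2_eq_square power3_eq_cube)
  moreover have "qpoch_inf (x ^ 3) (x ^ 3) * qpoch_inf (- x\<^sup>2) (x ^ 3) * qpoch_inf (- x) (x ^ 3) =
      euler_prod (x\<^sup>2) * (euler_prod (x ^ 3))\<^sup>2 / (euler_prod x * euler_prod (x ^ 6))"
  proof -
    define A where "A = qpoch_inf (- x) (x ^ 3) * qpoch_inf (- x\<^sup>2) (x ^ 3)"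
    define B where "B = qpoch_inf (- (x ^ 3)) (x ^ 3)"
    have 1: "euler_prod (x\<^sup>2) = A * B * euler_prod x"
      using qpoch_inf_uminus_self[OF assms(2)] qpoch_inf_split3[OF assms(2), of "- x"]
      by (simp add: A_def B_def power2_eq_square power3_eq_cube mult_ac)
    have 2: "euler_prod (x ^ 6) = B * euler_prod (x ^ 3)"
      using qpoch_inf_uminus_self[OF x3] by (simp add: B_def flip: power_mult)
    have "A * euler_prod (x ^ 3) = euler_prod (x\<^sup>2) * (euler_prod (x ^ 3))\<^sup>2 / (euler_prod x * euler_prod (x ^ 6))"
      using euler_prod_nonzero[OF assms(2)] euler_prod_nonzero[OF x3] euler_prod_nonzero[OF x6]
      unfolding 1 2 by (simp add: power2_eq_square)
    then show ?thesis by (simp add: A_def euler_prod_def mult_ac)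
  qed
  ultimately show ?thesis
    using jacobi_triple_product[OF _ x3, of "- x\<^sup>2"] assms by simp
qed

text \<open>In Ramanujan's two-variable notation this is \<open>f(-x, -x^5)\<close>. Its product is
  \<open>(x; x^2)\<close> with the exponents divisible by 3 removed.\<close>

lemma octagonal_has_sum:
  assumes "x \<noteq> 0" "norm x < 1"
  shows "((\<lambda>k. (- 1) powi k * x powi (3 * k * k - 2 * k)) has_sum
    (euler_prod x * (euler_prod (x ^ 6))\<^sup>2 / (euler_prod (x\<^sup>2) * euler_prod (x ^ 3)))) UNIV"
proof -
  have x2: "norm (x\<^sup>2) < 1" by (intro norm_power_less_1 assms) simp
  have x3: "norm (x ^ 3) < 1" by (intro norm_power_less_1 assms) simp
  have x6: "norm (x ^ 6) < 1" by (intro norm_power_less_1 assms) simp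
  have "theta_term x (x ^ 6) k = (- 1) powi k * x powi (3 * k * k - 2 * k)" for k
  proof -
    have "(x ^ 6) powi (k * (k - 1) div 2) = x powi (6 * (k * (k - 1) div 2))"
      by (simp only: power_int_mult power_int_numeral)
    moreover have "3 * k * k - 2 * k = k + 6 * (k * (k - 1) div 2)"
    proof -
      define t where "t = k * (k - 1) div 2"
      have "2 * t = k * (k - 1)" unfolding t_def by (rule two_mult_div_2) simp
      then show ?thesis unfolding t_def [symmetric] by (simp add: algebra_simps)
    qed
    ultimately show ?thesis
      using assms by (simp add: theta_term_def power_int_add power_int_minus_left)
  qed
  then have "theta_term x (x ^ 6) = (\<lambda>k. (- 1) powi k * x powi (3 * k * k - 2 * k))" by auto
  moreover have "x ^ 6 / x = x ^ 5" using assms by (simp add: eval_nat_numeral)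
  moreover have "qpoch_inf (x ^ 6) (x ^ 6) * qpoch_inf x (x ^ 6) * qpoch_inf (x ^ 5) (x ^ 6) =
      euler_prod x * (euler_prod (x ^ 6))\<^sup>2 / (euler_prod (x\<^sup>2) * euler_prod (x ^ 3))"
  proof -
    define A where "A = qpoch_inf x (x ^ 6) * qpoch_inf (x ^ 5) (x ^ 6)"
    define B where "B = qpoch_inf (x ^ 3) (x ^ 6)"
    have "(x\<^sup>2) ^ 3 = x ^ 6" "x * x\<^sup>2 = x ^ 3" "x * (x\<^sup>2)\<^sup>2 = x ^ 5" by (simp_all add: eval_nat_numeral)
    then have 1: "euler_prod x = A * B * euler_prod (x\<^sup>2)"
      using euler_prod_split2[OF assms(2)] qpoch_inf_split3[OF x2, of x]
      by (simp add: A_def B_def mult_ac)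
    have 2: "euler_prod (x ^ 3) = B * euler_prod (x ^ 6)"
      using euler_prod_split2[OF x3] by (simp add: B_def flip: power_mult)
    have "A * euler_prod (x ^ 6) = euler_prod x * (euler_prod (x ^ 6))\<^sup>2 / (euler_prod (x\<^sup>2) * euler_prod (x ^ 3))"
      using euler_prod_nonzero[OF x2] euler_prod_nonzero[OF x3] euler_prod_nonzero[OF x6]
      unfolding 1 2 by (simp add: power2_eq_square)
    then show ?thesis by (simp add: A_def euler_prod_def mult_ac)
  qed
  ultimately show ?thesis
    using jacobi_triple_product[OF _ x6 assms(1)] assms by simp
qed

section \<open>Residue classes of bilateral sums, and the 2- and 3-dissections\<close>

lemma has_sum_int_mod2:
  fixes f :: "int \<Rightarrow> complex"
  assumes "((\<lambda>k. f (2 * k)) has_sum A) UNIV" "((\<lambda>k. f (2 * k + 1)) has_sum B) UNIV"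
  shows "(f has_sum (A + B)) UNIV"
proof -
  have "(f has_sum A) (range (\<lambda>k. 2 * k))"
    using assms(1) by (subst has_sum_reindex) (auto simp: o_def inj_def)
  moreover have "(f has_sum B) (range (\<lambda>k. 2 * k + 1))"
    using assms(2) by (subst has_sum_reindex) (auto simp: o_def inj_def)
  moreover have "range (\<lambda>k::int. 2 * k) \<inter> range (\<lambda>k. 2 * k + 1) = {}"
    by (auto) presburger
  moreover have "range (\<lambda>k::int. 2 * k) \<union> range (\<lambda>k. 2 * k + 1) = UNIV"
    by (auto simp: image_iff) presburger
  ultimately show ?thesis using has_sum_Un_disjoint by metis
qed

text \<open>The last class is written \<open>3 * k - 1\<close> because in the dissections below the
  substitution of \<open>- k\<close> for \<open>k\<close> then turns one class sum into
  another.\<close>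

lemma has_sum_int_mod3:
  fixes f :: "int \<Rightarrow> complex"
  assumes "((\<lambda>k. f (3 * k)) has_sum A) UNIV" "((\<lambda>k. f (3 * k + 1)) has_sum B) UNIV"
    "((\<lambda>k. f (3 * k - 1)) has_sum C) UNIV"
  shows "(f has_sum (A + B + C)) UNIV"
proof -
  have "(f has_sum A) (range (\<lambda>k. 3 * k))"
    using assms(1) by (subst has_sum_reindex) (auto simp: o_def inj_def)
  moreover have "(f has_sum B) (range (\<lambda>k. 3 * k + 1))"
    using assms(2) by (subst has_sum_reindex) (auto simp: o_def inj_def)
  moreover have "range (\<lambda>k::int. 3 * k) \<inter> range (\<lambda>k. 3 * k + 1) = {}"
    by (auto) presburger
  ultimately have "(f has_sum (A + B)) (range (\<lambda>k. 3 * k) \<union> range (\<lambda>k. 3 * k + 1))"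
    by (rule has_sum_Un_disjoint)
  moreover have "(f has_sum C) (range (\<lambda>k. 3 * k - 1))"
    using assms(3) by (subst has_sum_reindex) (auto simp: o_def inj_def)
  moreover have "(range (\<lambda>k::int. 3 * k) \<union> range (\<lambda>k. 3 * k + 1)) \<inter> range (\<lambda>k. 3 * k - 1) = {}"
    by (auto) presburger+
  moreover have "range (\<lambda>k::int. 3 * k) \<union> range (\<lambda>k. 3 * k + 1) \<union> range (\<lambda>k. 3 * k - 1) = UNIV"
    by (auto simp: image_iff) presburger
  ultimately show ?thesis using has_sum_Un_disjoint by metis
qed

lemma has_sum_int_uminus:
  fixes f :: "int \<Rightarrow> complex"
  shows "(f has_sum A) UNIV \<Longrightarrow> ((\<lambda>k. f (- k)) has_sum A) UNIV"
  by (erule has_sum_reindex_bij_witness[of UNIV uminus uminus UNIV, THEN iffD1, rotated -1]) auto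

text \<open>Even indices give squares \<open>4 k^2\<close>, odd ones \<open>1 + 8 T\<close> with
  \<open>T\<close> triangular. The even class carries no signs, hence the argument
  \<open>- (x ^ 4)\<close>, whose sign cancels the one built into \<open>theta_phi\<close>.\<close>

lemma theta_phi_mod2:
  assumes "x \<noteq> 0" "norm x < 1"
  shows "theta_phi x = theta_phi (- (x ^ 4)) - 2 * x * theta_psi (x ^ 8)"
proof -
  have x4: "norm (- (x ^ 4)) < 1" using norm_power_less_1[OF assms(2), of 4] by simp
  have x8: "norm (x ^ 8) < 1" by (intro norm_power_less_1 assms) simp
  let ?f = "\<lambda>k. (- 1) powi k * x powi (k * k)"
  have "?f (2 * k) = (- 1) powi k * (- (x ^ 4)) powi (k * k)" for k
  proof -
    have "(x ^ 4) powi (k * k) = x powi (4 * (k * k))" by (simp only: power_int_mult power_int_numeral)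
    moreover have "(- (x ^ 4)) powi (k * k) = (- 1) powi k * (x ^ 4) powi (k * k)"
      using power_int_mult_distrib[of "- 1" "x ^ 4" "k * k"] by (simp add: minus_1_powi_square)
    moreover have "(- 1) powi k * (- 1) powi k = (1 :: complex)"
      by (simp add: power_int_minus_left)
    ultimately show ?thesis by (simp add: power_int_mult power_int_minus_left mult_ac)
  qed
  then have "((\<lambda>k. ?f (2 * k)) has_sum theta_phi (- (x ^ 4))) UNIV"
    using theta_phi_has_sum[OF _ x4] assms by simp
  moreover have "?f (2 * k + 1) = (- x) * (x ^ 8) powi (k * (k + 1) div 2)" for k
  proof -
    have "(x ^ 8) powi (k * (k + 1) div 2) = x powi (8 * (k * (k + 1) div 2))"
      by (simp only: power_int_mult power_int_numeral)
    moreover have "(2 * k + 1) * (2 * k + 1) = 1 + 8 * (k * (k + 1) div 2)"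
    proof -
      define t where "t = k * (k + 1) div 2"
      have "2 * t = k * (k + 1)" unfolding t_def by (rule two_mult_div_2) simp
      then show ?thesis unfolding t_def [symmetric] by (simp add: algebra_simps)
    qed
    ultimately show ?thesis using assms by (simp add: power_int_add power_int_minus_left)
  qed
  then have "((\<lambda>k. ?f (2 * k + 1)) has_sum ((- x) * (2 * theta_psi (x ^ 8)))) UNIV"
    using has_sum_cmult_right[OF theta_psi_has_sum[OF _ x8], of "- x"] assms by simp
  ultimately have "(?f has_sum (theta_phi (- (x ^ 4)) + (- x) * (2 * theta_psi (x ^ 8)))) UNIV"
    by (rule has_sum_int_mod2)
  then show ?thesis
    using theta_phi_has_sum[OF assms] has_sum_unique by fastforce
qed

text \<open>Indices divisible by 3 reproduce the series at \<open>x ^ 9\<close>. The other two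
  classes agree by symmetry, and \<open>(3k-1)^2 = 1 + 3(3k^2 - 2k)\<close> makes each an octagonal
  series at \<open>x ^ 3\<close>.\<close>

lemma theta_phi_mod3:
  assumes "x \<noteq> 0" "norm x < 1"
  shows "theta_phi x = theta_phi (x ^ 9) -
    2 * x * (euler_prod (x ^ 3) * (euler_prod (x ^ 18))\<^sup>2 / (euler_prod (x ^ 6) * euler_prod (x ^ 9)))"
    (is "_ = _ - 2 * x * ?A")
proof -
  have x3: "norm (x ^ 3) < 1" by (intro norm_power_less_1 assms) simp
  have x9: "norm (x ^ 9) < 1" by (intro norm_power_less_1 assms) simp
  let ?f = "\<lambda>k. (- 1) powi k * x powi (k * k)"
  have "?f (3 * k) = (- 1) powi k * (x ^ 9) powi (k * k)" for k
  proof -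
    have "(x ^ 9) powi (k * k) = x powi (9 * (k * k))" by (simp only: power_int_mult power_int_numeral)
    then show ?thesis by (simp add: power_int_minus_left)
  qed
  then have "((\<lambda>k. ?f (3 * k)) has_sum theta_phi (x ^ 9)) UNIV"
    using theta_phi_has_sum[OF _ x9] assms by simp
  moreover have "?f (3 * k - 1) = (- x) * ((- 1) powi k * (x ^ 3) powi (3 * k * k - 2 * k))" for k
  proof -
    have "(x ^ 3) powi (3 * k * k - 2 * k) = x powi (3 * (3 * k * k - 2 * k))"
      by (simp only: power_int_mult power_int_numeral)
    moreover have "(3 * k - 1) * (3 * k - 1) = 1 + 3 * (3 * k * k - 2 * k)" by (simp add: algebra_simps)
    ultimately show ?thesis using assms by (simp add: power_int_add power_int_minus_left)
  qed
  then have C: "((\<lambda>k. ?f (3 * k - 1)) has_sum ((- x) * ?A)) UNIV"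
    using has_sum_cmult_right[OF octagonal_has_sum[OF _ x3], of "- x"] assms by (simp flip: power_mult)
  moreover have "?f (3 * (- k) - 1) = ?f (3 * k + 1)" for k
    by (simp add: power_int_minus_left algebra_simps)
  then have "((\<lambda>k. ?f (3 * k + 1)) has_sum ((- x) * ?A)) UNIV"
    using has_sum_int_uminus[OF C] by simp
  ultimately have "(?f has_sum (theta_phi (x ^ 9) + (- x) * ?A + (- x) * ?A)) UNIV"
    using has_sum_int_mod3[of ?f] by blast
  then have "theta_phi x = theta_phi (x ^ 9) + (- x) * ?A + (- x) * ?A"
    using theta_phi_has_sum[OF assms] has_sum_unique by blast
  then show ?thesis by simp
qed

text \<open>The class \<open>3 k + 1\<close> reproduces the series, since its triangular numbers are
  \<open>1 + 9 k(k+1)/2\<close>. The other two classes agree by symmetry and are pentagonal series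
  at \<open>x ^ 3\<close>.\<close>

lemma theta_psi_mod3:
  assumes "x \<noteq> 0" "norm x < 1"
  shows "theta_psi x = x * theta_psi (x ^ 9) +
    euler_prod (x ^ 6) * (euler_prod (x ^ 9))\<^sup>2 / (euler_prod (x ^ 3) * euler_prod (x ^ 18))"
    (is "_ = _ + ?A")
proof -
  have x3: "norm (x ^ 3) < 1" by (intro norm_power_less_1 assms) simp
  have x9: "norm (x ^ 9) < 1" by (intro norm_power_less_1 assms) simp
  let ?f = "\<lambda>k. x powi (k * (k + 1) div 2)"
  have "?f (3 * k + 1) = x * (x ^ 9) powi (k * (k + 1) div 2)" for k
  proof -
    have "(x ^ 9) powi (k * (k + 1) div 2) = x powi (9 * (k * (k + 1) div 2))"
      by (simp only: power_int_mult power_int_numeral)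
    moreover have "(3 * k + 1) * (3 * k + 1 + 1) div 2 = 1 + 9 * (k * (k + 1) div 2)"
    proof -
      define t where "t = k * (k + 1) div 2"
      have "2 * t = k * (k + 1)" unfolding t_def by (rule two_mult_div_2) simp
      then have "(3 * k + 1) * (3 * k + 1 + 1) = (1 + 9 * (k * (k + 1) div 2)) * 2" unfolding t_def [symmetric] by (simp add: algebra_simps)
      then show ?thesis by simp
    qed
    ultimately show ?thesis using assms by (simp add: power_int_add)
  qed
  then have "((\<lambda>k. ?f (3 * k + 1)) has_sum (x * (2 * theta_psi (x ^ 9)))) UNIV"
    using has_sum_cmult_right[OF theta_psi_has_sum[OF _ x9], of x] assms by simp
  moreover have "?f (3 * k) = (x ^ 3) powi ((3 * k * k + k) div 2)" for k
  proof -
    have "(x ^ 3) powi ((3 * k * k + k) div 2) = x powi (3 * ((3 * k * k + k) div 2))"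
      by (simp only: power_int_mult power_int_numeral)
    moreover have "3 * k * (3 * k + 1) div 2 = 3 * ((3 * k * k + k) div 2)"
    proof -
      define t where "t = (3 * k * k + k) div 2"
      have "2 * t = 3 * k * k + k" unfolding t_def by (rule two_mult_div_2) simp
      then have "3 * k * (3 * k + 1) = 3 * ((3 * k * k + k) div 2) * 2"
        unfolding t_def [symmetric] by (simp add: algebra_simps)
      then show ?thesis by (simp only:)
    qed
    ultimately show ?thesis by simp
  qed
  then have A: "((\<lambda>k. ?f (3 * k)) has_sum ?A) UNIV"
    using pentagonal_has_sum[OF _ x3] assms by (simp flip: power_mult)
  moreover have "?f (3 * (- k)) = ?f (3 * k - 1)" for k
    by (simp add: algebra_simps)
  then have "((\<lambda>k. ?f (3 * k - 1)) has_sum ?A) UNIV"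
    using has_sum_int_uminus[OF A] by simp
  ultimately have "(?f has_sum (?A + x * (2 * theta_psi (x ^ 9)) + ?A)) UNIV"
    using has_sum_int_mod3[of ?f] by blast
  then have "2 * theta_psi x = ?A + x * (2 * theta_psi (x ^ 9)) + ?A"
    using theta_psi_has_sum[OF assms] has_sum_unique by blast
  then have "2 * theta_psi x = 2 * (x * theta_psi (x ^ 9) + ?A)" by (simp add: algebra_simps)
  then show ?thesis by (simp only: mult_cancel_left) simp
qed

section \<open>Quadratic and cubic theta relations\<close>

lemma euler_prod_uminus_eq:
  assumes "norm x < 1"
  shows "euler_prod (- x) = euler_prod (x\<^sup>2) ^ 3 / (euler_prod x * euler_prod (x ^ 4))"
  using euler_prod_uminus[OF assms] euler_prod_nonzero[OF assms]
    euler_prod_nonzero[OF norm_power_less_1[OF assms], of 4]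
  by (simp add: eq_divide_eq mult_ac)

lemma theta_phi_mult_uminus:
  assumes "norm x < 1"
  shows "theta_phi x * theta_phi (- x) = (theta_phi (x\<^sup>2))\<^sup>2"
  using euler_prod_nonzero[OF assms] euler_prod_nonzero[OF norm_power_less_1[OF assms], of 2]
    euler_prod_nonzero[OF norm_power_less_1[OF assms], of 4]
  by (simp add: theta_phi_def euler_prod_uminus_eq[OF assms] field_simps eval_nat_numeral)

lemma theta_phi_uminus_mult_theta_psi:
  assumes "norm x < 1"
  shows "theta_phi (- x) * theta_psi (x\<^sup>2) = (theta_psi x)\<^sup>2"
  using euler_prod_nonzero[OF assms] euler_prod_nonzero[OF norm_power_less_1[OF assms], of 2]
    euler_prod_nonzero[OF norm_power_less_1[OF assms], of 4]
  by (simp add: theta_phi_def theta_psi_def euler_prod_uminus_eq[OF assms] field_simps eval_nat_numeral)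

text \<open>With the 2-dissection \<open>\<alpha> -+ 2 x \<beta>\<close>, the difference of fourth
  powers is \<open>16 x \<alpha> \<beta> (\<alpha>^2 + 4 x^2 \<beta>^2)\<close>; the product
  relations identify both \<open>\<alpha> \<beta>\<close> and the last factor with theta
  values.\<close>

theorem jacobi_quartic:
  assumes "x \<noteq> 0" "norm x < 1"
  shows "theta_phi (- x) ^ 4 - theta_phi x ^ 4 = 16 * x * theta_psi (x\<^sup>2) ^ 4"
proof -
  define \<alpha> where "\<alpha> = theta_phi (- (x ^ 4))"
  define \<beta> where "\<beta> = theta_psi (x ^ 8)"
  have x2: "norm (x\<^sup>2) < 1" and x4: "norm (x ^ 4) < 1"
    by (intro norm_power_less_1 assms; simp)+
  have 1: "theta_phi x = \<alpha> - 2 * x * \<beta>" "theta_phi (- x) = \<alpha> + 2 * x * \<beta>"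
    using theta_phi_mod2[OF assms] theta_phi_mod2[of "- x"] assms by (simp_all add: \<alpha>_def \<beta>_def)
  \<comment> \<open>The 2-dissection at \<open>x^2\<close> gives the difference of the squares at
    \<open>- x^2\<close> and \<open>x^2\<close>; the second square is known from
    \<open>theta_phi_mult_uminus\<close>.\<close>
  have "theta_phi (x\<^sup>2) = theta_phi (- (x ^ 8)) - 2 * x\<^sup>2 * theta_psi (x ^ 16)"
    "theta_phi (- x\<^sup>2) = theta_phi (- (x ^ 8)) + 2 * x\<^sup>2 * theta_psi (x ^ 16)"
    using theta_phi_mod2[OF _ x2] theta_phi_mod2[of "- x\<^sup>2"] x2 assms by (simp_all flip: power_mult)
  then have "(theta_phi (- x\<^sup>2))\<^sup>2 - (theta_phi (x\<^sup>2))\<^sup>2 = 8 * x\<^sup>2 * (theta_phi (- (x ^ 8)) * theta_psi (x ^ 16))"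
    by (simp add: power2_sum power2_diff)
  also have "theta_phi (- (x ^ 8)) * theta_psi (x ^ 16) = \<beta>\<^sup>2"
    using theta_phi_uminus_mult_theta_psi[of "x ^ 8"] norm_power_less_1[OF assms(2)]
    by (simp add: \<beta>_def flip: power_mult)
  finally have "(theta_phi (- x\<^sup>2))\<^sup>2 = (theta_phi (x\<^sup>2))\<^sup>2 + 8 * x\<^sup>2 * \<beta>\<^sup>2"
    by (simp add: algebra_simps)
  also have "(theta_phi (x\<^sup>2))\<^sup>2 = \<alpha>\<^sup>2 - 4 * x\<^sup>2 * \<beta>\<^sup>2"
    using theta_phi_mult_uminus[OF assms(2)] unfolding 1 by (simp add: power2_eq_square algebra_simps)
  finally have 2: "(theta_phi (- x\<^sup>2))\<^sup>2 = \<alpha>\<^sup>2 + 4 * x\<^sup>2 * \<beta>\<^sup>2" by (simp add: algebra_simps)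
  have 3: "\<alpha> * \<beta> = (theta_psi (x ^ 4))\<^sup>2"
    using theta_phi_uminus_mult_theta_psi[OF x4] by (simp add: \<alpha>_def \<beta>_def flip: power_mult)
  have 4: "theta_phi (- x\<^sup>2) * theta_psi (x ^ 4) = (theta_psi (x\<^sup>2))\<^sup>2"
    using theta_phi_uminus_mult_theta_psi[OF x2] by (simp flip: power_mult)
  have "theta_phi (- x) ^ 4 - theta_phi x ^ 4 = 16 * x * (\<alpha> * \<beta>) * (\<alpha>\<^sup>2 + 4 * x\<^sup>2 * \<beta>\<^sup>2)"
    unfolding 1 by algebra
  also have "\<dots> = 16 * x * (theta_phi (- x\<^sup>2) * theta_psi (x ^ 4))\<^sup>2"
    unfolding 3 2[symmetric] by (simp add: power_mult_distrib)
  also have "\<dots> = 16 * x * theta_psi (x\<^sup>2) ^ 4"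
    unfolding 4 by (simp flip: power_mult)
  finally show ?thesis .
qed

section \<open>The cubic parameter and its relations\<close>

text \<open>Ramanujan's cubic continued fraction at \<open>x^3\<close>, with \<open>x\<close> as the
  chosen cube root. The form \<open>x\<close> times a function of \<open>x^3\<close> governs its
  behaviour under cube roots of unity.\<close>

definition cubic_w :: "complex \<Rightarrow> complex" where
  "cubic_w x = x * (euler_prod (x ^ 3) * euler_prod (x ^ 18) ^ 3 / (euler_prod (x ^ 6) * euler_prod (x ^ 9) ^ 3))"

lemma euler_prod_power_nonzero: "norm x < 1 \<Longrightarrow> n > 0 \<Longrightarrow> euler_prod (x ^ n) \<noteq> 0"
  by (intro euler_prod_nonzero norm_power_less_1)

lemma cubic_w_nonzero:
  assumes x: "x \<noteq> 0" "norm x < 1"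
  shows "cubic_w x \<noteq> 0"
  using x by (simp add: cubic_w_def euler_prod_power_nonzero[OF x(2)])

lemma theta_phi_cubic_w:
  assumes x: "x \<noteq> 0" "norm x < 1"
  shows "theta_phi x = theta_phi (x ^ 9) * (1 - 2 * cubic_w x)"
proof -
  define e3 e6 e9 e18 where "e3 = euler_prod (x ^ 3)" and "e6 = euler_prod (x ^ 6)"
    and "e9 = euler_prod (x ^ 9)" and "e18 = euler_prod (x ^ 18)"
  note e = e3_def e6_def e9_def e18_def
  have nz: "e3 \<noteq> 0" "e6 \<noteq> 0" "e9 \<noteq> 0" "e18 \<noteq> 0" by (simp_all add: e euler_prod_power_nonzero[OF x(2)])
  have h1: "theta_phi (x ^ 9) = e9\<^sup>2 / e18" by (simp add: theta_phi_def e flip: power_mult)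
  have h2: "cubic_w x = x * (e3 * e18 ^ 3 / (e6 * e9 ^ 3))" by (simp add: cubic_w_def e)
  have h3: "theta_phi x = theta_phi (x ^ 9) - 2 * x * (e3 * e18\<^sup>2 / (e6 * e9))"
    using theta_phi_mod3[OF x] by (simp only: e)
  show ?thesis unfolding h3 h1 h2
    using nz x by (simp add: field_simps power2_eq_square power3_eq_cube)
qed

text \<open>The parameter from the dissection of \<open>theta_phi\<close> reappears inverted; this
  shared parameter ties the two theta functions together.\<close>

lemma theta_psi_cubic_w:
  assumes x: "x \<noteq> 0" "norm x < 1"
  shows "theta_psi x = x * theta_psi (x ^ 9) * (1 + 1 / cubic_w x)"
proof -
  define e3 e6 e9 e18 where "e3 = euler_prod (x ^ 3)" and "e6 = euler_prod (x ^ 6)"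
    and "e9 = euler_prod (x ^ 9)" and "e18 = euler_prod (x ^ 18)"
  note e = e3_def e6_def e9_def e18_def
  have nz: "e3 \<noteq> 0" "e6 \<noteq> 0" "e9 \<noteq> 0" "e18 \<noteq> 0" by (simp_all add: e euler_prod_power_nonzero[OF x(2)])
  have h1: "theta_psi (x ^ 9) = e18\<^sup>2 / e9" by (simp add: theta_psi_def e flip: power_mult)
  have h2: "cubic_w x = x * (e3 * e18 ^ 3 / (e6 * e9 ^ 3))" by (simp add: cubic_w_def e)
  have h3: "theta_psi x = x * theta_psi (x ^ 9) + e6 * e9\<^sup>2 / (e3 * e18)"
    using theta_psi_mod3[OF x] by (simp only: e)
  show ?thesis unfolding h3 h1 h2
    using nz x by (simp add: field_simps power2_eq_square power3_eq_cube)
qed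

lemma cubic_w_uminus:
  assumes x: "x \<noteq> 0" "norm x < 1"
  shows "cubic_w (- x) = - x * ((euler_prod (x ^ 6))\<^sup>2 * euler_prod (x ^ 9) ^ 3 * euler_prod (x ^ 36) ^ 3 /
    (euler_prod (x ^ 3) * euler_prod (x ^ 12) * euler_prod (x ^ 18) ^ 6))"
proof -
  define e3 e6 e9 e12 e18 e36 where "e3 = euler_prod (x ^ 3)" and "e6 = euler_prod (x ^ 6)"
    and "e9 = euler_prod (x ^ 9)" and "e12 = euler_prod (x ^ 12)"
    and "e18 = euler_prod (x ^ 18)" and "e36 = euler_prod (x ^ 36)"
  note e = e3_def e6_def e9_def e12_def e18_def e36_def
  have nz: "e3 \<noteq> 0" "e6 \<noteq> 0" "e9 \<noteq> 0" "e12 \<noteq> 0" "e18 \<noteq> 0" "e36 \<noteq> 0"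
    by (simp_all add: e euler_prod_power_nonzero[OF x(2)])
  have m: "euler_prod (- (x ^ 3)) = e6 ^ 3 / (e3 * e12)" "euler_prod (- (x ^ 9)) = e18 ^ 3 / (e9 * e36)"
    using euler_prod_uminus_eq[of "x ^ 3"] euler_prod_uminus_eq[of "x ^ 9"] norm_power_less_1[OF x(2)]
    by (simp_all add: e flip: power_mult)
  have "cubic_w (- x) = - x * (e6 ^ 3 / (e3 * e12) * e18 ^ 3 / (e6 * (e18 ^ 3 / (e9 * e36)) ^ 3))"
    by (simp add: cubic_w_def m) (simp add: e)
  also have "\<dots> = - x * (e6\<^sup>2 * e9 ^ 3 * e36 ^ 3 / (e3 * e12 * e18 ^ 6))"
    using nz by (simp add: field_simps eval_nat_numeral)
  finally show ?thesis unfolding e .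
qed

lemma cubic_w_mult_uminus:
  assumes x: "x \<noteq> 0" "norm x < 1"
  shows "cubic_w x * cubic_w (- x) = - cubic_w (x\<^sup>2)"
proof -
  define e3 e6 e9 e12 e18 e36 where "e3 = euler_prod (x ^ 3)" and "e6 = euler_prod (x ^ 6)"
    and "e9 = euler_prod (x ^ 9)" and "e12 = euler_prod (x ^ 12)"
    and "e18 = euler_prod (x ^ 18)" and "e36 = euler_prod (x ^ 36)"
  note e = e3_def e6_def e9_def e12_def e18_def e36_def
  have nz: "e3 \<noteq> 0" "e6 \<noteq> 0" "e9 \<noteq> 0" "e12 \<noteq> 0" "e18 \<noteq> 0" "e36 \<noteq> 0"
    by (simp_all add: e euler_prod_power_nonzero[OF x(2)])
  have h1: "cubic_w (x\<^sup>2) = x\<^sup>2 * (e6 * e36 ^ 3 / (e12 * e18 ^ 3))"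
    by (simp add: cubic_w_def e flip: power_mult)
  have h2: "cubic_w x = x * (e3 * e18 ^ 3 / (e6 * e9 ^ 3))" by (simp add: cubic_w_def e)
  have h3: "cubic_w (- x) = - x * (e6\<^sup>2 * e9 ^ 3 * e36 ^ 3 / (e3 * e12 * e18 ^ 6))"
    unfolding e by (rule cubic_w_uminus[OF x])
  show ?thesis unfolding h3 h1 h2
    using nz x by (simp add: field_simps eval_nat_numeral)
qed

text \<open>Dividing \<open>theta_phi_mult_uminus\<close> at \<open>x\<close> by its instance at
  \<open>x ^ 9\<close> leaves \<open>(1 - 2a)(1 - 2b) = (1 - 2c)^2\<close> for the values
  \<open>a\<close>, \<open>b\<close>, \<open>c\<close> at \<open>x\<close>, \<open>- x\<close>,
  \<open>x^2\<close>. Inserting \<open>a b = - c\<close> isolates \<open>a + b\<close>.\<close>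

lemma cubic_w_add_uminus:
  assumes x: "x \<noteq> 0" "norm x < 1"
  shows "cubic_w x + cubic_w (- x) = - 2 * (cubic_w (x\<^sup>2))\<^sup>2"
proof -
  have x2: "norm (x\<^sup>2) < 1" by (intro norm_power_less_1 x) simp
  have nz: "theta_phi (x ^ 18) \<noteq> 0"
    by (simp add: theta_phi_def euler_prod_power_nonzero[OF x(2)] flip: power_mult)
  have 1: "theta_phi (- x) = theta_phi (- (x ^ 9)) * (1 - 2 * cubic_w (- x))"
    using theta_phi_cubic_w[of "- x"] x by simp
  have 2: "theta_phi (x\<^sup>2) = theta_phi (x ^ 18) * (1 - 2 * cubic_w (x\<^sup>2))"
    using theta_phi_cubic_w[OF _ x2] x by (simp flip: power_mult)
  have 3: "theta_phi (x ^ 9) * theta_phi (- (x ^ 9)) = (theta_phi (x ^ 18))\<^sup>2"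
    using theta_phi_mult_uminus[of "x ^ 9"] norm_power_less_1[OF x(2)] by (simp flip: power_mult)
  have "(theta_phi (x ^ 9) * theta_phi (- (x ^ 9))) * ((1 - 2 * cubic_w x) * (1 - 2 * cubic_w (- x))) =
      (theta_phi (x ^ 18))\<^sup>2 * (1 - 2 * cubic_w (x\<^sup>2))\<^sup>2"
    using theta_phi_mult_uminus[OF x(2)] unfolding 1 2 theta_phi_cubic_w[OF x]
    by (simp add: power_mult_distrib mult_ac)
  then have "(1 - 2 * cubic_w x) * (1 - 2 * cubic_w (- x)) = (1 - 2 * cubic_w (x\<^sup>2))\<^sup>2"
    using nz unfolding 3 by simp
  then have "2 * (cubic_w x + cubic_w (- x)) = 4 * (cubic_w x * cubic_w (- x)) + 4 * cubic_w (x\<^sup>2) - 4 * (cubic_w (x\<^sup>2))\<^sup>2"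
    by (simp add: power2_eq_square algebra_simps)
  also have "\<dots> = 2 * (- 2 * (cubic_w (x\<^sup>2))\<^sup>2)"
    unfolding cubic_w_mult_uminus[OF x] by simp
  finally show ?thesis by (simp only: mult_cancel_left) simp
qed

lemma cubic_w_root_of_unity: "w ^ 3 = 1 \<Longrightarrow> cubic_w (w * x) = w * cubic_w x"
proof -
  assume "w ^ 3 = 1"
  then have "w ^ (3 * n) = 1" for n by (simp add: power_mult)
  from this[of 1] this[of 2] this[of 3] this[of 6]
  show ?thesis by (simp add: cubic_w_def power_mult_distrib)
qed

text \<open>The linear relations at \<open>x\<close>, \<open>w x\<close>, \<open>w^2 x\<close> are
  multiplied. The linear factors in \<open>cubic_w\<close> combine to cubic ones, and the theta
  values combine by \<open>euler_prod_cube_root\<close>.\<close>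

lemma theta_cubes:
  assumes x: "x \<noteq> 0" "norm x < 1"
  shows "theta_phi (x ^ 3) ^ 4 = theta_phi (x ^ 9) ^ 4 * (1 - 8 * cubic_w x ^ 3)"
    and "theta_psi (x ^ 3) ^ 4 = x ^ 3 * theta_psi (x ^ 9) ^ 4 * (1 + 1 / cubic_w x ^ 3)"
proof -
  define w where "w = Complex (- 1 / 2) (sqrt 3 / 2)"
  have w: "w\<^sup>2 + w + 1 = 0"
    by (simp add: w_def complex_eq_iff power2_eq_square)
  have w3: "w ^ 3 = 1" using w by algebra
  have nw: "norm w = 1" by (simp add: w_def cmod_def power_divide)
  have w6: "(w\<^sup>2) ^ 3 = 1" using w3 by algebra
  have w9: "w ^ 9 = 1" using w3 power_mult[of w 3 3] by simp
  define e1 e2 e3 e6 e9 e18 where "e1 = euler_prod x" and "e2 = euler_prod (x\<^sup>2)"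
    and "e3 = euler_prod (x ^ 3)" and "e6 = euler_prod (x ^ 6)"
    and "e9 = euler_prod (x ^ 9)" and "e18 = euler_prod (x ^ 18)"
  define u1 u2 v1 v2 where "u1 = euler_prod (w * x)" and "u2 = euler_prod (w\<^sup>2 * x)"
    and "v1 = euler_prod ((w * x)\<^sup>2)" and "v2 = euler_prod ((w\<^sup>2 * x)\<^sup>2)"
  note e = e1_def e2_def e3_def e6_def e9_def e18_def u1_def u2_def v1_def v2_def
  have nz: "e1 \<noteq> 0" "e2 \<noteq> 0" "e3 \<noteq> 0" "e6 \<noteq> 0" "e9 \<noteq> 0" "e18 \<noteq> 0"
    by (simp_all add: e euler_prod_power_nonzero[OF x(2)] euler_prod_nonzero[OF x(2)])
  have nx: "w * x \<noteq> 0" "norm (w * x) < 1" "w\<^sup>2 * x \<noteq> 0" "norm (w\<^sup>2 * x) < 1"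
    using x nw w3 by (auto simp: norm_mult norm_power)
  have nzu: "u1 \<noteq> 0" "u2 \<noteq> 0" "v1 \<noteq> 0" "v2 \<noteq> 0"
    unfolding e by (intro euler_prod_nonzero euler_prod_power_nonzero nx; simp)+
  have u: "e1 * u1 * u2 * e9 = e3 ^ 4"
    unfolding e by (rule euler_prod_cube_root[OF x(2) w])
  \<comment> \<open>Squaring permutes the two nontrivial rotations, so the cube-root product formula
    also applies at \<open>x^2\<close>.\<close>
  have "(w * x)\<^sup>2 = w\<^sup>2 * x\<^sup>2" by (rule power_mult_distrib)
  moreover have "(w\<^sup>2 * x)\<^sup>2 = w * x\<^sup>2" using w3 by algebra
  ultimately have v: "e2 * v1 * v2 * e18 = e6 ^ 4"
    using euler_prod_cube_root[OF norm_power_less_1[OF x(2)] w, of 2]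
    by (simp add: e mult_ac flip: power_mult)
  have phi9: "theta_phi (x ^ 9) = e9\<^sup>2 / e18" and phi3: "theta_phi (x ^ 3) = e3\<^sup>2 / e6"
    and psi9: "theta_psi (x ^ 9) = e18\<^sup>2 / e9" and psi3: "theta_psi (x ^ 3) = e6\<^sup>2 / e3"
    by (simp_all add: theta_phi_def theta_psi_def e flip: power_mult)
  define W where "W = cubic_w x"
  have W: "W \<noteq> 0" unfolding W_def by (rule cubic_w_nonzero[OF x])
  have w0: "w \<noteq> 0" using w3 by auto
  have cw: "cubic_w (w * x) = w * W" "cubic_w (w\<^sup>2 * x) = w\<^sup>2 * W"
    unfolding W_def by (rule cubic_w_root_of_unity w3 w6)+
  have wx9: "(w * x) ^ 9 = x ^ 9" "(w\<^sup>2 * x) ^ 9 = x ^ 9"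
    using w9 power_mult[of w 9 2] by (simp_all add: power_mult_distrib power_mult[symmetric])
  have p: "theta_phi x = theta_phi (x ^ 9) * (1 - 2 * W)"
    "theta_phi (w * x) = theta_phi (x ^ 9) * (1 - 2 * (w * W))"
    "theta_phi (w\<^sup>2 * x) = theta_phi (x ^ 9) * (1 - 2 * (w\<^sup>2 * W))"
    using theta_phi_cubic_w[OF x] theta_phi_cubic_w[OF nx(1,2)] theta_phi_cubic_w[OF nx(3,4)]
    unfolding cw wx9 by (simp_all only: W_def)
  have s: "theta_psi x = x * theta_psi (x ^ 9) * (1 + 1 / W)"
    "theta_psi (w * x) = w * x * theta_psi (x ^ 9) * (1 + 1 / (w * W))"
    "theta_psi (w\<^sup>2 * x) = w\<^sup>2 * x * theta_psi (x ^ 9) * (1 + 1 / (w\<^sup>2 * W))"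
    using theta_psi_cubic_w[OF x] theta_psi_cubic_w[OF nx(1,2)] theta_psi_cubic_w[OF nx(3,4)]
    unfolding cw wx9 by (simp_all only: W_def)
  have "theta_phi (x ^ 3) ^ 4 = theta_phi (x ^ 9) * (theta_phi x * theta_phi (w * x) * theta_phi (w\<^sup>2 * x))"
  proof -
    have "theta_phi x * theta_phi (w * x) * theta_phi (w\<^sup>2 * x) = (e1 * u1 * u2)\<^sup>2 / (e2 * v1 * v2)"
      by (simp add: theta_phi_def e power_mult_distrib)
    also have "e1 * u1 * u2 = e3 ^ 4 / e9" using u nz by (simp add: eq_divide_eq)
    also have "e2 * v1 * v2 = e6 ^ 4 / e18" using v nz by (simp add: eq_divide_eq)
    finally show ?thesis unfolding phi3 phi9 using nz by (simp add: field_simps eval_nat_numeral)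
  qed
  also have "\<dots> = theta_phi (x ^ 9) ^ 4 * ((1 - 2 * W) * (1 - 2 * (w * W)) * (1 - 2 * (w\<^sup>2 * W)))"
    unfolding p by (simp add: eval_nat_numeral mult_ac)
  also have "(1 - 2 * W) * (1 - 2 * (w * W)) * (1 - 2 * (w\<^sup>2 * W)) = 1 - 8 * W ^ 3"
    using w by algebra
  finally show "theta_phi (x ^ 3) ^ 4 = theta_phi (x ^ 9) ^ 4 * (1 - 8 * cubic_w x ^ 3)"
    unfolding W_def .
  have "theta_psi (x ^ 3) ^ 4 = theta_psi (x ^ 9) * (theta_psi x * theta_psi (w * x) * theta_psi (w\<^sup>2 * x))"
  proof -
    have "theta_psi x * theta_psi (w * x) * theta_psi (w\<^sup>2 * x) = (e2 * v1 * v2)\<^sup>2 / (e1 * u1 * u2)"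
      by (simp add: theta_psi_def e power_mult_distrib)
    also have "e1 * u1 * u2 = e3 ^ 4 / e9" using u nz by (simp add: eq_divide_eq)
    also have "e2 * v1 * v2 = e6 ^ 4 / e18" using v nz by (simp add: eq_divide_eq)
    finally show ?thesis unfolding psi3 psi9 using nz by (simp add: field_simps eval_nat_numeral)
  qed
  \<comment> \<open>The factor \<open>w * w^2\<close> comes from the leading arguments
    \<open>w x\<close> and \<open>w^2 x\<close>; it cancels the powers of \<open>w\<close> in the
    denominators.\<close>
  also have "\<dots> = x ^ 3 * theta_psi (x ^ 9) ^ 4 * (w * w\<^sup>2 * ((1 + 1 / W) * (1 + 1 / (w * W)) * (1 + 1 / (w\<^sup>2 * W))))"
    unfolding s by (simp add: power3_eq_cube power4_eq_xxxx mult_ac)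
  also have "w * w\<^sup>2 * ((1 + 1 / W) * (1 + 1 / (w * W)) * (1 + 1 / (w\<^sup>2 * W))) =
      (W + 1) * (w * W + 1) * (w\<^sup>2 * W + 1) / W ^ 3"
    using W w0 by (simp add: field_simps power3_eq_cube)
  also have "(W + 1) * (w * W + 1) * (w\<^sup>2 * W + 1) = W ^ 3 + 1"
    using w by algebra
  also have "(W ^ 3 + 1) / W ^ 3 = 1 + 1 / W ^ 3" using W by (simp add: field_simps)
  finally show "theta_psi (x ^ 3) ^ 4 = x ^ 3 * theta_psi (x ^ 9) ^ 4 * (1 + 1 / cubic_w x ^ 3)"
    unfolding W_def .
qed

section \<open>The level 36 identity\<close>

text \<open>With \<open>x = q\<close> this is \<open>P / Q + Q / P = Z\<close> cleared of
  denominators, both sides carrying a common factor.\<close>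

lemma euler_prod_level_36:
  assumes x: "x \<noteq> 0" "norm x < 1"
  shows "((euler_prod x)\<^sup>2 * (euler_prod (x ^ 9))\<^sup>2 * euler_prod (x ^ 12) ^ 4 +
      x * (euler_prod (x ^ 4))\<^sup>2 * (euler_prod (x ^ 36))\<^sup>2 * euler_prod (x ^ 3) ^ 4) *
      ((euler_prod (x ^ 3))\<^sup>2 * (euler_prod (x ^ 12))\<^sup>2) =
    euler_prod (x ^ 6) ^ 8 * euler_prod x * euler_prod (x ^ 4) * euler_prod (x ^ 9) * euler_prod (x ^ 36)"
proof -
  define e1 e2 e3 e4 e6 where "e1 = euler_prod x" and "e2 = euler_prod (x\<^sup>2)"
    and "e3 = euler_prod (x ^ 3)" and "e4 = euler_prod (x ^ 4)" and "e6 = euler_prod (x ^ 6)"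
  define e9 e12 e18 e36 where "e9 = euler_prod (x ^ 9)" and "e12 = euler_prod (x ^ 12)"
    and "e18 = euler_prod (x ^ 18)" and "e36 = euler_prod (x ^ 36)"
  note e = e1_def e2_def e3_def e4_def e6_def e9_def e12_def e18_def e36_def
  have nz: "e1 \<noteq> 0" "e2 \<noteq> 0" "e3 \<noteq> 0" "e4 \<noteq> 0" "e6 \<noteq> 0" "e9 \<noteq> 0" "e12 \<noteq> 0" "e18 \<noteq> 0" "e36 \<noteq> 0"
    by (simp_all add: e euler_prod_power_nonzero[OF x(2)] euler_prod_nonzero[OF x(2)])
  have n2: "norm (x\<^sup>2) < 1" by (intro norm_power_less_1 x) simp
  have phi: "theta_phi x = e1\<^sup>2 / e2" "theta_phi (x ^ 3) = e3\<^sup>2 / e6" "theta_phi (x ^ 9) = e9\<^sup>2 / e18"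
    "theta_phi (x ^ 6) = e6\<^sup>2 / e12" "theta_phi (x ^ 18) = e18\<^sup>2 / e36"
    by (simp_all add: theta_phi_def e flip: power_mult)
  have um: "theta_psi (- y) = euler_prod y * euler_prod (y ^ 4) / euler_prod (y\<^sup>2)" if "norm y < 1" for y
    using euler_prod_nonzero[OF that] euler_prod_power_nonzero[OF that, of 2] euler_prod_power_nonzero[OF that, of 4]
    by (simp add: theta_psi_def euler_prod_uminus_eq[OF that] power2_eq_square power3_eq_cube)
  have psi: "theta_psi (- x) = e1 * e4 / e2" "theta_psi (- (x ^ 3)) = e3 * e12 / e6"
    "theta_psi (- (x ^ 9)) = e9 * e36 / e18"
    using um[OF x(2)] um[of "x ^ 3"] um[of "x ^ 9"] norm_power_less_1[OF x(2)]
    by (simp_all add: e flip: power_mult)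
  define a where "a = cubic_w x"
  define t where "t = - 1 / cubic_w (- x)"
  have b0: "cubic_w (- x) \<noteq> 0" by (rule cubic_w_nonzero) (use x in auto)
  have b: "cubic_w (- x) = - 1 / t" using b0 by (simp add: t_def)
  have t0: "t \<noteq> 0" using b0 by (simp add: t_def)
  have c: "cubic_w (x\<^sup>2) = a / t"
    using cubic_w_mult_uminus[OF x] by (simp add: b a_def)
  \<comment> \<open>This is \<open>a + b = - 2 c^2\<close> with \<open>b = - 1 / t\<close> and
    \<open>c = a / t\<close>, multiplied by \<open>t^2\<close>.\<close>
  have curve: "a * t\<^sup>2 - t + 2 * a\<^sup>2 = 0"
  proof -
    have "a * t\<^sup>2 - t = (a + - 1 / t) * t\<^sup>2"
      using t0 by (simp add: field_simps power2_eq_square)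
    also have "\<dots> = - 2 * (a / t)\<^sup>2 * t\<^sup>2"
      using cubic_w_add_uminus[OF x] unfolding c b a_def[symmetric] by simp
    also have "\<dots> = - 2 * a\<^sup>2" using t0 by (simp add: power_divide)
    finally show ?thesis by simp
  qed
  have t: "t = e3 * e12 * e18 ^ 6 / (x * e6\<^sup>2 * e9 ^ 3 * e36 ^ 3)"
    using nz x unfolding t_def cubic_w_uminus[OF x] e[symmetric] by (simp add: field_simps)

  \<comment> \<open>The linear factors are theta quotients by the 3-dissections, the cubic ones by
    \<open>theta_cubes\<close>.\<close>
  have A1: "1 - 2 * a = e1\<^sup>2 * e18 / (e2 * e9\<^sup>2)"
    using theta_phi_cubic_w[OF x] nz unfolding phi a_def[symmetric] by (simp add: field_simps)
  have A2: "(e9\<^sup>2 / e18) ^ 4 * (1 - 8 * a ^ 3) = (e3\<^sup>2 / e6) ^ 4"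
    using theta_cubes(1)[OF x] unfolding phi a_def[symmetric] by simp
  have T1: "t - 1 = (e1 * e4 / e2) / (x * (e9 * e36 / e18))"
    using theta_psi_cubic_w[of "- x"] x nz t0 by (simp add: psi b)
  have T2: "x ^ 3 * (e9 * e36 / e18) ^ 4 * (t ^ 3 - 1) = (e3 * e12 / e6) ^ 4"
  proof -
    have "theta_psi (- (x ^ 3)) ^ 4 = - (x ^ 3) * theta_psi (- (x ^ 9)) ^ 4 * (1 + 1 / cubic_w (- x) ^ 3)"
      using theta_cubes(2)[of "- x"] x by simp
    moreover have "1 + 1 / cubic_w (- x) ^ 3 = - (t ^ 3 - 1)"
      using t0 by (simp add: b power_divide)
    ultimately show ?thesis unfolding psi by (simp only: mult_minus_left mult_minus_right minus_minus)
  qed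
  have C: "(e18\<^sup>2 / e36) ^ 4 * (1 - 8 * (a / t) ^ 3) = (e6\<^sup>2 / e12) ^ 4"
    using theta_cubes(1)[OF _ n2] x by (simp add: phi c flip: power_mult)

  \<comment> \<open>The quadratic factors arise as cubic over linear: \<open>1 - 8 a^3\<close> by
    \<open>1 - 2 a\<close> here, \<open>t^3 - 1\<close> by \<open>t - 1\<close> next.\<close>
  have B1: "1 + 2 * a + 4 * a\<^sup>2 = (e3\<^sup>2 / e6) ^ 4 / ((e9\<^sup>2 / e18) ^ 4 * (e1\<^sup>2 * e18 / (e2 * e9\<^sup>2)))"
  proof -
    have "(1 + 2 * a + 4 * a\<^sup>2) * ((e9\<^sup>2 / e18) ^ 4 * (1 - 2 * a)) = (e9\<^sup>2 / e18) ^ 4 * (1 - 8 * a ^ 3)"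
      by algebra
    then show ?thesis
      unfolding A1 A2 by (intro eq_divide_imp) (use nz in simp)
  qed
  have B2: "t\<^sup>2 + t + 1 = (e3 * e12 / e6) ^ 4 / (x ^ 3 * (e9 * e36 / e18) ^ 4 * ((e1 * e4 / e2) / (x * (e9 * e36 / e18))))"
  proof -
    have "(t\<^sup>2 + t + 1) * (x ^ 3 * (e9 * e36 / e18) ^ 4 * (t - 1)) = x ^ 3 * (e9 * e36 / e18) ^ 4 * (t ^ 3 - 1)"
      by algebra
    then show ?thesis
      unfolding T1 T2 by (intro eq_divide_imp) (use nz x in simp)
  qed
  have B3: "t\<^sup>2 * (1 - 8 * (a / t) ^ 3) = t\<^sup>2 * ((e6\<^sup>2 / e12) ^ 4 / (e18\<^sup>2 / e36) ^ 4)"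
    unfolding C [symmetric] using nz by simp

  \<comment> \<open>The two summands stand in the ratio \<open>P\<^sup>2 : Q\<^sup>2\<close>, and modulo the curve their sum is again an eta quotient.\<close>
  have "((1 - 2 * a) * (t\<^sup>2 + t + 1) + (t - 1) * (1 + 2 * a + 4 * a\<^sup>2)) * t = t ^ 3 - 8 * a ^ 3"
    using curve by algebra
  also have "\<dots> = t\<^sup>2 * (1 - 8 * (a / t) ^ 3) * t"
    using t0 by (simp add: field_simps power2_eq_square power3_eq_cube)
  finally have "(1 - 2 * a) * (t\<^sup>2 + t + 1) + (t - 1) * (1 + 2 * a + 4 * a\<^sup>2) = t\<^sup>2 * (1 - 8 * (a / t) ^ 3)"
    using t0 by simp
  also note B3
  finally have key: "(1 - 2 * a) * (t\<^sup>2 + t + 1) + (t - 1) * (1 + 2 * a + 4 * a\<^sup>2) = t\<^sup>2 * ((e6\<^sup>2 / e12) ^ 4 / (e18\<^sup>2 / e36) ^ 4)" .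
  \<comment> \<open>The common multiplier that turns each of the three terms of \<open>key\<close>
    into the corresponding Euler product monomial of the claim.\<close>
  define K where "K = x\<^sup>2 * e9 ^ 6 * e36\<^sup>2 * e6 ^ 4 / e18 ^ 4 * (e1 * e9 * e4 * e36 / e3 ^ 4) * e3\<^sup>2 * e12\<^sup>2"
  have 1: "K * ((1 - 2 * a) * (t\<^sup>2 + t + 1)) = e1\<^sup>2 * e9\<^sup>2 * e12 ^ 4 * (e3\<^sup>2 * e12\<^sup>2)"
    unfolding A1 B2 K_def using nz x by (simp add: field_simps eval_nat_numeral)
  have 2: "K * ((t - 1) * (1 + 2 * a + 4 * a\<^sup>2)) = x * e4\<^sup>2 * e36\<^sup>2 * e3 ^ 4 * (e3\<^sup>2 * e12\<^sup>2)"
    unfolding T1 B1 K_def using nz x by (simp add: field_simps eval_nat_numeral)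
  have 3: "K * (t\<^sup>2 * ((e6\<^sup>2 / e12) ^ 4 / (e18\<^sup>2 / e36) ^ 4)) = e6 ^ 8 * e1 * e4 * e9 * e36"
    unfolding t K_def using nz x by (simp add: field_simps eval_nat_numeral)
  have "(e1\<^sup>2 * e9\<^sup>2 * e12 ^ 4 + x * e4\<^sup>2 * e36\<^sup>2 * e3 ^ 4) * (e3\<^sup>2 * e12\<^sup>2) =
      K * ((1 - 2 * a) * (t\<^sup>2 + t + 1)) + K * ((t - 1) * (1 + 2 * a + 4 * a\<^sup>2))"
    unfolding 1 2 by (rule distrib_right)
  also have "\<dots> = K * ((1 - 2 * a) * (t\<^sup>2 + t + 1) + (t - 1) * (1 + 2 * a + 4 * a\<^sup>2))"
    by (rule distrib_left [symmetric])
  also have "\<dots> = e6 ^ 8 * e1 * e4 * e9 * e36"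
    unfolding key by (rule 3)
  finally have "(e1\<^sup>2 * e9\<^sup>2 * e12 ^ 4 + x * e4\<^sup>2 * e36\<^sup>2 * e3 ^ 4) * (e3\<^sup>2 * e12\<^sup>2) = e6 ^ 8 * e1 * e4 * e9 * e36" .
  then show ?thesis unfolding e .
qed

section \<open>The quartic identity for Euler products and the modular equation\<close>

text \<open>\<open>jacobi_quartic\<close> after eliminating \<open>euler_prod (- x)\<close> by the
  sign rule and clearing denominators.\<close>

lemma euler_prod_jacobi_quartic:
  assumes x: "x \<noteq> 0" "norm x < 1"
  shows "euler_prod (x\<^sup>2) ^ 24 = euler_prod x ^ 8 * euler_prod (x ^ 4) ^ 8 *
    (euler_prod x ^ 8 + 16 * x * euler_prod (x ^ 4) ^ 8)"
proof -
  define e1 e2 e4 where "e1 = euler_prod x" and "e2 = euler_prod (x\<^sup>2)" and "e4 = euler_prod (x ^ 4)"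
  note e = e1_def e2_def e4_def
  have nz: "e1 \<noteq> 0" "e2 \<noteq> 0" "e4 \<noteq> 0"
    by (simp_all add: e euler_prod_power_nonzero[OF x(2)] euler_prod_nonzero[OF x(2)])
  have "theta_phi x = e1\<^sup>2 / e2" "theta_psi (x\<^sup>2) = e4\<^sup>2 / e2"
    "theta_phi (- x) = (e2 ^ 3 / (e1 * e4))\<^sup>2 / e2"
    by (simp_all add: theta_phi_def theta_psi_def euler_prod_uminus_eq[OF x(2)] e flip: power_mult)
  then have "((e2 ^ 3 / (e1 * e4))\<^sup>2 / e2) ^ 4 - (e1\<^sup>2 / e2) ^ 4 = 16 * x * (e4\<^sup>2 / e2) ^ 4"
    using jacobi_quartic[OF x] by simp
  moreover have "((e2 ^ 3 / (e1 * e4))\<^sup>2 / e2) ^ 4 = e2 ^ 24 / (e1 ^ 8 * e4 ^ 8 * e2 ^ 4)"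
    using nz by (simp add: field_simps eval_nat_numeral)
  moreover have "(e1\<^sup>2 / e2) ^ 4 = e1 ^ 8 / e2 ^ 4" "(e4\<^sup>2 / e2) ^ 4 = e4 ^ 8 / e2 ^ 4"
    by (simp_all add: power_divide flip: power_mult)
  ultimately have "e2 ^ 24 / (e1 ^ 8 * e4 ^ 8 * e2 ^ 4) = (e1 ^ 8 + 16 * x * e4 ^ 8) / e2 ^ 4"
    by (simp add: diff_eq_eq add_divide_distrib)
  moreover have "e2 ^ 24 = e2 ^ 24 / (e1 ^ 8 * e4 ^ 8 * e2 ^ 4) * (e1 ^ 8 * e4 ^ 8 * e2 ^ 4)"
    using nz by simp
  ultimately have "e2 ^ 24 = (e1 ^ 8 + 16 * x * e4 ^ 8) / e2 ^ 4 * (e1 ^ 8 * e4 ^ 8 * e2 ^ 4)"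
    by (simp only:)
  also have "\<dots> = e1 ^ 8 * e4 ^ 8 * (e1 ^ 8 + 16 * x * e4 ^ 8)"
    using nz by simp
  finally have "e2 ^ 24 = e1 ^ 8 * e4 ^ 8 * (e1 ^ 8 + 16 * x * e4 ^ 8)" .
  then show ?thesis unfolding e .
qed

theorem theorem3p4:
  fixes q r P Q :: complex
  assumes "0 < norm q" and "norm q < 1"
    and "r ^ 8 = q"
    and "P = (ramanujan_f (- q) * ramanujan_f (- (q ^ 9))) /
             (r ^ 10 * ramanujan_f (- (q ^ 4)) * ramanujan_f (- (q ^ 36)))"
    and "Q = (ramanujan_f (- (q ^ 3)))\<^sup>2 / (r ^ 6 * (ramanujan_f (- (q ^ 12)))\<^sup>2)"
  shows "(P / Q + Q / P) ^ 3 = Q\<^sup>2 + 16 / Q\<^sup>2"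
proof -
  have q: "q \<noteq> 0" "norm q < 1" using assms(1,2) by auto
  then have r: "r \<noteq> 0" using assms(3) by auto
  define e1 e3 e4 e6 where "e1 = euler_prod q" and "e3 = euler_prod (q ^ 3)"
    and "e4 = euler_prod (q ^ 4)" and "e6 = euler_prod (q ^ 6)"
  define e9 e12 e36 where "e9 = euler_prod (q ^ 9)" and "e12 = euler_prod (q ^ 12)"
    and "e36 = euler_prod (q ^ 36)"
  note e = e1_def e3_def e4_def e6_def e9_def e12_def e36_def
  have nz: "e1 \<noteq> 0" "e3 \<noteq> 0" "e4 \<noteq> 0" "e6 \<noteq> 0" "e9 \<noteq> 0" "e12 \<noteq> 0" "e36 \<noteq> 0"
    by (simp_all add: e euler_prod_power_nonzero[OF q(2)] euler_prod_nonzero[OF q(2)])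
  have P: "P = e1 * e9 / (r ^ 10 * e4 * e36)" and Q: "Q = e3\<^sup>2 / (r ^ 6 * e12\<^sup>2)"
    unfolding assms(4,5) ramanujan_f_uminus e by (rule refl)+
  have level_36: "(e1\<^sup>2 * e9\<^sup>2 * e12 ^ 4 + r ^ 8 * e4\<^sup>2 * e36\<^sup>2 * e3 ^ 4) * (e3\<^sup>2 * e12\<^sup>2) = e6 ^ 8 * e1 * e4 * e9 * e36"
    unfolding assms(3) e by (rule euler_prod_level_36[OF q])
  \<comment> \<open>The quartic identity is taken at \<open>q^3\<close>, where the linear
    coefficient becomes \<open>16 r^24\<close>.\<close>
  have "euler_prod (q ^ 6) ^ 24 = euler_prod (q ^ 3) ^ 8 * euler_prod (q ^ 12) ^ 8 *
      (euler_prod (q ^ 3) ^ 8 + 16 * q ^ 3 * euler_prod (q ^ 12) ^ 8)"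
    using euler_prod_jacobi_quartic[of "q ^ 3"] q norm_power_less_1[OF q(2), of 3] by (simp flip: power_mult)
  then have quartic: "e6 ^ 24 = e3 ^ 8 * e12 ^ 8 * (e3 ^ 8 + 16 * r ^ 24 * e12 ^ 8)"
    unfolding e assms(3)[symmetric] by (simp flip: power_mult)
  \<comment> \<open>The fraction is expanded by \<open>e3^2 e12^2\<close>, so that its numerator is
    the left side of \<open>level_36\<close>.\<close>
  have "P / Q + Q / P = (e1\<^sup>2 * e9\<^sup>2 * e12 ^ 4 + r ^ 8 * e4\<^sup>2 * e36\<^sup>2 * e3 ^ 4) * (e3\<^sup>2 * e12\<^sup>2) /
      (r ^ 4 * e1 * e9 * e4 * e36 * e3 ^ 4 * e12 ^ 4)"
    unfolding P Q using nz r by (simp add: field_simps eval_nat_numeral)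
  also have "\<dots> = e6 ^ 8 / (r ^ 4 * e3 ^ 4 * e12 ^ 4)"
    unfolding level_36 using nz by (simp add: field_simps)
  finally have "(P / Q + Q / P) ^ 3 = e6 ^ 24 / (r ^ 12 * e3 ^ 12 * e12 ^ 12)"
    by (simp add: power_divide power_mult_distrib flip: power_mult)
  \<comment> \<open>The two summands of \<open>quartic\<close> become \<open>Q^2\<close> and
    \<open>16 / Q^2\<close> separately.\<close>
  also have "\<dots> = e3 ^ 4 / (r ^ 12 * e12 ^ 4) + 16 * r ^ 12 * e12 ^ 4 / e3 ^ 4"
    unfolding quartic using nz r by (simp add: field_simps eval_nat_numeral)
  also have "\<dots> = Q\<^sup>2 + 16 / Q\<^sup>2"
    unfolding Q by (simp add: power_divide power_mult_distrib flip: power_mult)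
  finally show ?thesis .
qed

end
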